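(* There exist absolute constants $c_1,c_2>0$ such that the following holds. Let $\mu,\nu$ be centered log-concave probability measures on $\mathbb{R}^n$ with densities satisfying $\|f_\mu\|_\infty=\|f_\nu\|_\infty$. Let $X_1,X_2,\ldots$ be independent random points distributed according to $\mu$ and $K_N=\mathrm{conv}\{X_1,\ldots,X_N\}$. Then for every $N>n$ with $N\leq\exp(c_1n/L_\mu^2)$, $$\mathbb{E}_{\mu^N}(\nu(K_N))\leq 2\exp\left(-c_2n/L_\mu^2\right).$$
   Context: A log-concave probability measure on $\mathbb{R}^n$ is a Borel probability measure with $\mu(\lambda A+(1-\lambda)B)\geq\mu(A)^\lambda\mu(B)^{1-\lambda}$ for compact $A,B$, $\lambda\in(0,1)$, and $\mu(H)<1$ for every hyperplane $H$; it has density $f_\mu$. Centered means barycenter at $0$. $L_\mu=\|f_\mu\|_\infty^{1/n}[\det\mathrm{Cov}(\mu)]^{1/(2n)}$. *)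

theory Defs
  imports "HOL-Probability.Probability"
begin

text \<open>Model of R^n: functions nat => real vanishing at all indices >= n, inside
  the Polish space nat => real (product topology, Borel sigma-algebra).\<close>

definition Rn :: "nat \<Rightarrow> (nat \<Rightarrow> real) set" where
  "Rn n = {x. \<forall>i\<ge>n. x i = 0}"

definition lebn :: "nat \<Rightarrow> (nat \<Rightarrow> real) measure" where
  "lebn n = distr (PiM {..<n} (\<lambda>_. lborel)) borel (\<lambda>x i. if i < n then x i else 0)"

definition mink_comb :: "real \<Rightarrow> (nat \<Rightarrow> real) set \<Rightarrow> (nat \<Rightarrow> real) set \<Rightarrow> (nat \<Rightarrow> real) set" where
  "mink_comb t A B = {(\<lambda>i. t * a i + (1 - t) * b i) | a b. a \<in> A \<and> b \<in> B}"

definition hyperplane :: "nat \<Rightarrow> (nat \<Rightarrow> real) set \<Rightarrow> bool" where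
  "hyperplane n H \<longleftrightarrow> (\<exists>a b. (\<exists>i<n. a i \<noteq> 0) \<and> H = {x \<in> Rn n. (\<Sum>i<n. a i * x i) = b})"

definition log_concave :: "nat \<Rightarrow> (nat \<Rightarrow> real) measure \<Rightarrow> bool" where
  "log_concave n \<mu> \<longleftrightarrow>
     prob_space \<mu> \<and> sets \<mu> = sets borel \<and> emeasure \<mu> (Rn n) = 1 \<and>
     (\<forall>A B t. compact A \<and> compact B \<and> A \<subseteq> Rn n \<and> B \<subseteq> Rn n \<and> 0 < t \<and> t < 1 \<longrightarrow>
        measure \<mu> (mink_comb t A B) \<ge> measure \<mu> A powr t * measure \<mu> B powr (1 - t)) \<and>
     (\<forall>H. hyperplane n H \<longrightarrow> measure \<mu> H < 1)"

definition centered :: "nat \<Rightarrow> (nat \<Rightarrow> real) measure \<Rightarrow> bool" where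
  "centered n \<mu> \<longleftrightarrow> (\<forall>i<n. integrable \<mu> (\<lambda>x. x i) \<and> (\<integral>x. x i \<partial>\<mu>) = 0)"

definition dens :: "nat \<Rightarrow> (nat \<Rightarrow> real) measure \<Rightarrow> (nat \<Rightarrow> real) \<Rightarrow> ennreal" where
  "dens n \<mu> = RN_deriv (lebn n) \<mu>"

definition dens_sup :: "nat \<Rightarrow> (nat \<Rightarrow> real) measure \<Rightarrow> real" where
  "dens_sup n \<mu> = enn2real (esssup (lebn n) (dens n \<mu>))"

definition cov :: "(nat \<Rightarrow> real) measure \<Rightarrow> nat \<Rightarrow> nat \<Rightarrow> real" where
  "cov \<mu> i j = (\<integral>x. x i * x j \<partial>\<mu>) - (\<integral>x. x i \<partial>\<mu>) * (\<integral>x. x j \<partial>\<mu>)"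

definition detn :: "nat \<Rightarrow> (nat \<Rightarrow> nat \<Rightarrow> real) \<Rightarrow> real" where
  "detn n M = (\<Sum>p | p permutes {..<n}. of_int (sign p) * (\<Prod>i<n. M i (p i)))"

definition isotropic_const :: "nat \<Rightarrow> (nat \<Rightarrow> real) measure \<Rightarrow> real" where
  "isotropic_const n \<mu> = dens_sup n \<mu> powr (1 / real n) * detn n (cov \<mu>) powr (1 / (2 * real n))"

definition convhull :: "(nat \<Rightarrow> real) set \<Rightarrow> (nat \<Rightarrow> real) set" where
  "convhull S = \<Inter>{C. S \<subseteq> C \<and> (\<forall>x\<in>C. \<forall>y\<in>C. \<forall>t::real. 0 \<le> t \<and> t \<le> 1 \<longrightarrow>
        (\<lambda>i. t * x i + (1 - t) * y i) \<in> C)}"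

end

theory Submission
  imports Defs "Jordan_Normal_Form.Determinant"
begin

text \<open>
  A point with large half-space depth for \<open>\<mu>\<close> stays deep for averages: if every half-space through \<open>x\<close>
  has \<open>\<mu>\<close>-measure at least \<open>e\<^sup>-\<^sup>T\<close>, then every half-space through \<open>m x\<close> has measure at least \<open>e\<^sup>-\<^sup>m\<^sup>T\<close> for
  the law of a sum of \<open>m\<close> independent copies. With \<open>m\<close> of order \<open>n / T\<close> this is \<open>e\<^sup>-\<^sup>n\<close>, a depth at which
  log-concavity alone controls volumes: the points of depth \<open>e\<^sup>-\<^sup>n\<close> of a log-concave density \<open>f\<close> lie in
  the convex set where \<open>f\<close> exceeds \<open>e\<^sup>-\<^sup>C\<^sup>n\<close> times its maximum, whose volume is at most \<open>e\<^sup>C\<^sup>n\<close> divided by that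
  maximum. The covariance of the sum bounds its maximal density from below, so the points of
  \<open>\<mu>\<close>-depth \<open>e\<^sup>-\<^sup>T\<close> fill a convex set of volume at most \<open>(C \<surd>(T / n))\<^sup>n \<surd>det Cov(\<mu>)\<close>. For \<open>T\<close> a small multiple of
  \<open>n / L\<^sub>\<mu>\<^sup>2\<close> its \<open>\<nu>\<close>-measure is at most \<open>e\<^sup>-\<^sup>n\<close>, while any other point lies in the hull of the sample
  with probability at most \<open>N e\<^sup>-\<^sup>T\<close>.

  To avoid densities of \<open>\<mu>\<close>, the sum is started from a Gaussian with covariance proportional to that
  of \<open>\<mu>\<close>; log-concavity survives each convolution by the Prekopa-Leindler inequality for \<open>\<mu>\<close>.
\<close>

section \<open>The Prekopa-Leindler inequality for log-concave measures\<close>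

text \<open>With \<open>a1\<close> the maximum of \<open>A\<close> and \<open>b0\<close> the minimum
  of \<open>B\<close>, the translates \<open>A + b0\<close> and \<open>B + a1\<close> both lie in
  \<open>C\<close> and meet at most in the point \<open>a1 + b0\<close>, so their lengths add
  up.\<close>

lemma compact_brunn_minkowski_real:
  fixes A B C :: "real set"
  assumes "compact A" "compact B" "A \<noteq> {}" "B \<noteq> {}" and C: "C \<in> sets borel"
    and sub: "\<And>a b. a \<in> A \<Longrightarrow> b \<in> B \<Longrightarrow> a + b \<in> C"
  shows "emeasure lborel A + emeasure lborel B \<le> emeasure lborel C"
proof -
  obtain a1 where a1: "a1 \<in> A" "\<And>a. a \<in> A \<Longrightarrow> a \<le> a1"
    using compact_attains_sup[OF assms(1,3)] by auto
  obtain b0 where b0: "b0 \<in> B" "\<And>b. b \<in> B \<Longrightarrow> b0 \<le> b"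
    using compact_attains_inf[OF assms(2,4)] by auto
  have [measurable]: "A \<in> sets borel" "B \<in> sets borel"
    using assms by (auto intro: borel_compact)
  define A' where "A' = (+) (- b0) -` A"
  define B' where "B' = (+) (- a1) -` B"
  have trans: "emeasure lborel ((+) c -` S) = emeasure lborel S" if "S \<in> sets borel" for c :: real and S
  proof -
    have "emeasure lborel S = emeasure (distr lborel borel ((+) c)) S"
      by (simp only: lborel_distr_plus)
    also have "\<dots> = emeasure lborel ((+) c -` S)"
      using that by (subst emeasure_distr) auto
    finally show ?thesis by simp
  qed
  have A': "A' \<in> sets borel" "emeasure lborel A' = emeasure lborel A"
    unfolding A'_def using trans[of A "-b0"] by (auto intro: measurable_sets_borel[OF _ \<open>A \<in> sets borel\<close>])
  have B': "B' \<in> sets borel" "emeasure lborel B' = emeasure lborel B"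
    unfolding B'_def using trans[of B "-a1"] by (auto intro: measurable_sets_borel[OF _ \<open>B \<in> sets borel\<close>])
  have le: "u \<le> a1 + b0" if "u \<in> A'" for u
    using a1(2)[of "u - b0"] that by (auto simp: A'_def)
  have ge: "u \<ge> a1 + b0" if "u \<in> B'" for u
    using b0(2)[of "u - a1"] that by (auto simp: B'_def)
  have "emeasure lborel A' + emeasure lborel B' = emeasure lborel (A' - {a1 + b0}) + emeasure lborel B'"
    using A' by (subst emeasure_Diff_null_set) (auto simp: null_sets_def)
  also have "\<dots> = emeasure lborel ((A' - {a1 + b0}) \<union> B')"
    using A' B' le ge by (intro plus_emeasure) (auto, fastforce)
  also have "\<dots> \<le> emeasure lborel C"
  proof (intro emeasure_mono)
    have "u \<in> C" if "u \<in> A'" for u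
      using sub[of "u - b0" b0] that b0 by (auto simp: A'_def)
    moreover have "u \<in> C" if "u \<in> B'" for u
      using sub[of a1 "u - a1"] that a1 by (auto simp: B'_def)
    ultimately show "(A' - {a1 + b0}) \<union> B' \<subseteq> C" by auto
  qed (use C in auto)
  finally show ?thesis using A' B' by simp
qed

text \<open>Inner regularity of finite measures is applied to Lebesgue measure restricted to
  \<open>{-k..k}\<close>; letting \<open>k\<close> grow removes the truncation and covers sets of
  infinite length.\<close>

lemma lborel_real_inner_regular:
  fixes A :: "real set"
  assumes A: "A \<in> sets borel"
  shows "emeasure lborel A = (SUP K \<in> {K. K \<subseteq> A \<and> compact K}. emeasure lborel K)" (is "_ = ?S")
proof (rule antisym)
  have "emeasure lborel (A \<inter> {-real k..real k}) \<le> ?S" for k :: nat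
  proof -
    define M where "M = density lborel (indicator {-real k..real k} :: real \<Rightarrow> ennreal)"
    have em: "emeasure M S = emeasure lborel (S \<inter> {-real k..real k})" if "S \<in> sets borel" for S
      unfolding M_def using that
      by (subst emeasure_density)
        (auto intro!: nn_integral_cong simp: nn_integral_indicator[symmetric] indicator_def
          simp del: nn_integral_indicator)
    have "emeasure lborel (A \<inter> {-real k..real k}) = (SUP K \<in> {K. K \<subseteq> A \<and> compact K}. emeasure M K)"
      by (subst em[symmetric, OF A], rule inner_regular) (auto simp: M_def emeasure_density assms)
    also have "\<dots> \<le> ?S"
    proof (rule SUP_mono)
      fix K assume K: "K \<in> {K. K \<subseteq> A \<and> compact K}"
      then have "emeasure M K \<le> emeasure lborel K"
        by (subst em) (auto intro!: emeasure_mono borel_compact)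
      with K show "\<exists>L\<in>{K. K \<subseteq> A \<and> compact K}. emeasure M K \<le> emeasure lborel L" by blast
    qed
    finally show ?thesis .
  qed
  then have "(SUP k::nat. emeasure lborel (A \<inter> {-real k..real k})) \<le> ?S"
    by (rule SUP_least)
  also have "(SUP k::nat. emeasure lborel (A \<inter> {-real k..real k})) = emeasure lborel (\<Union>k::nat. A \<inter> {-real k..real k})"
    using A by (intro SUP_emeasure_incseq) (auto simp: incseq_def)
  also have "(\<Union>k::nat. A \<inter> {-real k..real k}) = A"
  proof -
    have "\<exists>k::nat. -real k \<le> x \<and> x \<le> real k" for x :: real
      using real_arch_simple[of "\<bar>x\<bar>"] by (auto simp: abs_le_iff) (metis minus_le_iff)
    then show ?thesis by auto
  qed
  finally show "emeasure lborel A \<le> ?S" .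
qed (use A in \<open>auto intro!: SUP_least emeasure_mono\<close>)

lemma brunn_minkowski_real:
  fixes A B C :: "real set"
  assumes A: "A \<in> sets borel" "A \<noteq> {}" and B: "B \<in> sets borel" "B \<noteq> {}" and C: "C \<in> sets borel"
    and sub: "\<And>a b. a \<in> A \<Longrightarrow> b \<in> B \<Longrightarrow> a + b \<in> C"
  shows "emeasure lborel A + emeasure lborel B \<le> emeasure lborel C"
proof -
  obtain a0 b0 where ab: "a0 \<in> A" "b0 \<in> B" using A B by auto
  have *: "emeasure lborel K + emeasure lborel K' \<le> emeasure lborel C"
    if "compact K" "K \<subseteq> A" "compact K'" "K' \<subseteq> B" for K K'
  proof -
    \<comment> \<open>The points \<open>a0\<close> and \<open>b0\<close> are inserted because the
      compact case asks for nonempty sets, while the suprema also range over the empty set.\<close>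
    have "emeasure lborel K + emeasure lborel K' \<le> emeasure lborel (insert a0 K) + emeasure lborel (insert b0 K')"
      using that by (intro add_mono emeasure_mono) (auto intro: borel_compact)
    also have "\<dots> \<le> emeasure lborel C"
      using that ab sub C by (intro compact_brunn_minkowski_real) auto
    finally show ?thesis .
  qed
  have ne: "{K. K \<subseteq> S \<and> compact K} \<noteq> {}" for S :: "real set" by auto
  show ?thesis
    unfolding lborel_real_inner_regular[OF A(1)] lborel_real_inner_regular[OF B(1)]
      ennreal_SUP_add_left[OF ne, symmetric]
    by (intro SUP_least; subst ennreal_SUP_add_right[OF ne]) (auto intro!: SUP_least *)
qed

text \<open>Layer-cake formula cut off at height 1: \<open>min (f x) 1\<close> is the length of the
  set of levels \<open>s\<close> in (0,1) below \<open>f x\<close>, and Tonelli exchanges the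
  integrals.\<close>

lemma nn_integral_min_one_levels:
  assumes "sigma_finite_measure M" and [measurable]: "f \<in> borel_measurable M"
    and f: "\<And>x. 0 \<le> f x"
  shows "(\<integral>\<^sup>+x. ennreal (min (f x) 1) \<partial>M) =
    (\<integral>\<^sup>+s. emeasure M {x \<in> space M. s < f x} * indicator {0<..<1::real} s \<partial>lborel)"
proof -
  interpret sigma_finite_measure M by fact
  interpret P: pair_sigma_finite M lborel
    by (simp add: pair_sigma_finite_def lborel.sigma_finite_measure_axioms assms(1))
  have 1: "ennreal (min u 1) = (\<integral>\<^sup>+s. indicator {0<..<1} s * indicator {..<u} s \<partial>lborel)" if "0 \<le> u" for u :: real
  proof -
    have "(\<integral>\<^sup>+s. indicator {0<..<1} s * indicator {..<u} s \<partial>lborel) = (\<integral>\<^sup>+s. indicator {0<..<min u 1} s \<partial>lborel)"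
      by (intro nn_integral_cong) (auto simp: indicator_def)
    also have "\<dots> = ennreal (min u 1)" using that by simp
    finally show ?thesis by simp
  qed
  have "(\<integral>\<^sup>+x. ennreal (min (f x) 1) \<partial>M) = (\<integral>\<^sup>+x. \<integral>\<^sup>+s. indicator {0<..<1} s * indicator {(x, s). s < f x} (x, s) \<partial>lborel \<partial>M)"
    by (intro nn_integral_cong) (auto simp: 1 f intro!: nn_integral_cong simp: indicator_def)
  also have "\<dots> = (\<integral>\<^sup>+s. \<integral>\<^sup>+x. indicator {0<..<1} s * indicator {(x, s). s < f x} (x, s) \<partial>M \<partial>lborel)"
    by (rule P.Fubini'[symmetric]) measurable
  also have "\<dots> = (\<integral>\<^sup>+s. emeasure M {x \<in> space M. s < f x} * indicator {0<..<1::real} s \<partial>lborel)"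
  proof (rule nn_integral_cong)
    fix s :: real
    have "(\<integral>\<^sup>+x. indicator {0<..<1} s * indicator {(x, s). s < f x} (x, s) \<partial>M) =
      indicator {0<..<1} s * (\<integral>\<^sup>+x. indicator {x \<in> space M. s < f x} x \<partial>M)"
      by (subst nn_integral_cmult[symmetric]) (auto intro!: nn_integral_cong simp: indicator_def)
    then show "(\<integral>\<^sup>+x. indicator {0<..<1} s * indicator {(x, s). s < f x} (x, s) \<partial>M) =
      emeasure M {x \<in> space M. s < f x} * indicator {0<..<1::real} s" by (simp add: mult.commute)
  qed
  finally show ?thesis .
qed

text \<open>After division by their suprema, \<open>f\<close> and \<open>g\<close> have nonempty
  superlevel sets at every level \<open>s < 1\<close>, so Brunn-Minkowski applies at each of these
  levels. Integrating over the levels bounds a weighted arithmetic mean of the normalised integrals,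
  and Young's inequality passes to the geometric mean.\<close>

lemma prekopa_leindler_real:
  fixes f g h :: "real \<Rightarrow> real"
  assumes [measurable]: "f \<in> borel_measurable borel" "g \<in> borel_measurable borel" "h \<in> borel_measurable borel"
    and nonneg: "\<And>x. 0 \<le> f x" "\<And>x. 0 \<le> g x" "\<And>x. 0 \<le> h x"
    and bdd: "bdd_above (range f)" "bdd_above (range g)"
    and t: "0 < t" "t < 1"
    and le: "\<And>x y. f x powr t * g y powr (1 - t) \<le> h (t * x + (1 - t) * y)"
    and I: "(\<integral>\<^sup>+x. ennreal (f x) \<partial>lborel) = ennreal I" "0 \<le> I"
    and J: "(\<integral>\<^sup>+x. ennreal (g x) \<partial>lborel) = ennreal J" "0 \<le> J"
    and K: "(\<integral>\<^sup>+x. ennreal (h x) \<partial>lborel) = ennreal K" "0 \<le> K"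
  shows "I powr t * J powr (1 - t) \<le> K"
proof (cases "I = 0 \<or> J = 0")
  case True
  then show ?thesis using K(2) t by auto
next
  case False
  with I J have pos: "0 < I" "0 < J" by auto
  have sup_pos: "0 < (SUP x. u x)" if "bdd_above (range u)" "(\<integral>\<^sup>+x. ennreal (u x) \<partial>lborel) = ennreal k" "0 < k" 
    for u :: "real \<Rightarrow> real" and k
  proof (rule ccontr)
    assume "\<not> ?thesis"
    then have "u x \<le> 0" for x using cSUP_upper[OF UNIV_I that(1), of x] by linarith
    then have "(\<integral>\<^sup>+x. ennreal (u x) \<partial>lborel) = 0" by (simp add: ennreal_neg)
    then show False using that by simp
  qed
  define F where "F = (SUP x. f x)"
  define G where "G = (SUP x. g x)"
  have F: "0 < F" "\<And>x. f x \<le> F" unfolding F_def using sup_pos[OF bdd(1) I(1) pos(1)] cSUP_upper[OF UNIV_I bdd(1)] by auto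
  have G: "0 < G" "\<And>x. g x \<le> G" unfolding G_def using sup_pos[OF bdd(2) J(1) pos(2)] cSUP_upper[OF UNIV_I bdd(2)] by auto
  \<comment> \<open>The scale for \<open>h\<close> that matches the normalisation of
    \<open>f\<close> and \<open>g\<close> in the hypothesis \<open>le\<close>.\<close>
  define H where "H = F powr t * G powr (1 - t)"
  have H: "0 < H" using F G by (simp add: H_def)
  have lev: "emeasure lborel {x. s < f x / F} * ennreal t + emeasure lborel {x. s < g x / G} * ennreal (1 - t)
      \<le> emeasure lborel {x. s < h x / H}" if s: "0 < s" "s < 1" for s
  proof -
    \<comment> \<open>Dilating the superlevel sets by \<open>t\<close> and \<open>1 - t\<close>
      turns the convex combination in \<open>le\<close> into the plain sum of Brunn-Minkowski and
      yields the weights on the two lengths.\<close>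
    define A where "A = {x. s < f (x / t) / F}"
    define B where "B = {x. s < g (x / (1 - t)) / G}"
    have [measurable]: "A \<in> sets borel" "B \<in> sets borel" unfolding A_def B_def by measurable
    have scale: "emeasure lborel {x. s < u (x / c) / w} = emeasure lborel {x. s < u x / w} * ennreal c"
      if "0 < c" and [measurable]: "u \<in> borel_measurable borel" for u :: "real \<Rightarrow> real" and c w
    proof -
      have "(\<integral>\<^sup>+x. indicator {x. s < u (x / c) / w} x \<partial>lborel) = ennreal \<bar>c\<bar> * (\<integral>\<^sup>+x. indicator {x. s < u (x / c) / w} (0 + c * x) \<partial>lborel)"
        using that by (intro nn_integral_real_affine) auto
      also have "(\<integral>\<^sup>+x. indicator {x. s < u (x / c) / w} (0 + c * x) \<partial>lborel) = (\<integral>\<^sup>+x. indicator {x. s < u x / w} x \<partial>lborel)"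
        using that by (intro nn_integral_cong) (auto simp: indicator_def)
      finally show ?thesis using that by (simp add: mult.commute)
    qed
    have "s * F < F" "s * G < G" using s F(1) G(1) by auto
    then obtain a b where "s * F < f a" "s * G < g b" 
      unfolding F_def G_def using less_cSUP_iff[of UNIV f] less_cSUP_iff[of UNIV g] bdd by auto
    then have ne: "t * a \<in> A" "(1 - t) * b \<in> B" using t F G by (auto simp: A_def B_def pos_less_divide_eq)
    have "emeasure lborel A + emeasure lborel B \<le> emeasure lborel {x. s < h x / H}"
    proof (rule brunn_minkowski_real)
      fix x y assume xy: "x \<in> A" "y \<in> B"
      have "s = s powr t * s powr (1 - t)" using s by (simp add: powr_add[symmetric])
      also have "\<dots> < (f (x / t) / F) powr t * (g (y / (1 - t)) / G) powr (1 - t)"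
        using xy s t by (intro mult_strict_mono powr_less_mono2) (auto simp: A_def B_def)
      also have "\<dots> = f (x / t) powr t * g (y / (1 - t)) powr (1 - t) / H"
        using F G nonneg by (simp add: powr_divide H_def)
      also have "\<dots> \<le> h (t * (x / t) + (1 - t) * (y / (1 - t))) / H"
        using H by (intro divide_right_mono le) auto
      finally show "x + y \<in> {x. s < h x / H}" using t by simp
    qed (use ne in auto)
    then show ?thesis using t by (simp add: A_def B_def scale)
  qed
  have total: "(\<integral>\<^sup>+s. emeasure lborel {x. s < u x / c} * indicator {0<..<1} s \<partial>lborel) =
      (\<integral>\<^sup>+x. ennreal (min (u x / c) 1) \<partial>lborel)"
    if "u \<in> borel_measurable borel" "\<And>x. 0 \<le> u x" "0 < c" for u c
    using nn_integral_min_one_levels[OF lborel.sigma_finite_measure_axioms, of "\<lambda>x. u x / c"] that by simp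
  have scaled: "(\<integral>\<^sup>+x. ennreal (u x / c) \<partial>lborel) = ennreal (k / c)"
    if "(\<integral>\<^sup>+x. ennreal (u x) \<partial>lborel) = ennreal k" "u \<in> borel_measurable borel" "\<And>x. 0 \<le> u x" "0 < c" "0 \<le> k" for u c k
    using that by (simp add: divide_ennreal[symmetric] nn_integral_divide)
  have lf: "(\<integral>\<^sup>+s. emeasure lborel {x. s < f x / F} * indicator {0<..<1} s \<partial>lborel) = ennreal (I / F)"
    using F nonneg I by (subst total) (auto simp: min_absorb1 scaled)
  have lg: "(\<integral>\<^sup>+s. emeasure lborel {x. s < g x / G} * indicator {0<..<1} s \<partial>lborel) = ennreal (J / G)"
    using G nonneg J by (subst total) (auto simp: min_absorb1 scaled)
  \<comment> \<open>Since \<open>h / H\<close> may exceed 1, the levels below 1 account for only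
    part of its integral; an upper bound is what the conclusion asks for.\<close>
  have lh: "(\<integral>\<^sup>+s. emeasure lborel {x. s < h x / H} * indicator {0<..<1} s \<partial>lborel) \<le> ennreal (K / H)"
  proof -
    have "(\<integral>\<^sup>+s. emeasure lborel {x. s < h x / H} * indicator {0<..<1} s \<partial>lborel) \<le> (\<integral>\<^sup>+x. ennreal (h x / H) \<partial>lborel)"
      using H nonneg by (subst total) (auto intro!: nn_integral_mono ennreal_leI)
    then show ?thesis using scaled[OF K(1) _ nonneg(3) H K(2)] by simp
  qed
  have mono: "(\<lambda>s. emeasure lborel {x. s < u x / c}) \<in> borel_measurable borel" if [measurable]: "u \<in> borel_measurable borel" for u :: "real \<Rightarrow> real" and c
    by measurable
  have "ennreal (I / F * t + J / G * (1 - t)) = ennreal (I / F) * ennreal t + ennreal (J / G) * ennreal (1 - t)"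
    using pos F G t by (subst ennreal_plus) (auto simp: ennreal_mult[symmetric])
  also have "\<dots> = (\<integral>\<^sup>+s. emeasure lborel {x. s < f x / F} * indicator {0<..<1} s * ennreal t +
      emeasure lborel {x. s < g x / G} * indicator {0<..<1} s * ennreal (1 - t) \<partial>lborel)"
    unfolding lf[symmetric] lg[symmetric] using mono
    by (subst nn_integral_add) (auto simp: nn_integral_multc)
  also have "\<dots> \<le> (\<integral>\<^sup>+s. emeasure lborel {x. s < h x / H} * indicator {0<..<1} s \<partial>lborel)"
    using lev by (intro nn_integral_mono) (auto simp: indicator_def)
  also have "\<dots> \<le> ennreal (K / H)" by (rule lh)
  finally have "I / F * t + J / G * (1 - t) \<le> K / H"
    using K(2) H by (simp add: ennreal_le_iff)
  moreover have "(I / F) powr t * (J / G) powr (1 - t) \<le> t * (I / F) + (1 - t) * (J / G)"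
    using pos F G t by (intro Youngs_inequality_0) auto
  moreover have "(I / F) powr t * (J / G) powr (1 - t) = I powr t * J powr (1 - t) / H"
    using pos F G by (simp add: powr_divide H_def)
  ultimately have "I powr t * J powr (1 - t) / H \<le> K / H" by (simp add: mult.commute)
  then show ?thesis using H by (simp add: divide_le_cancel)
qed

section \<open>From the real line to log-concave measures on \<open>Rn n\<close>\<close>

lemma Rn_borel [measurable]: "Rn n \<in> sets borel"
proof -
  have "Rn n = (\<Inter>i\<in>{n..}. {x. x i = 0})" by (auto simp: Rn_def)
  moreover have "closed {x :: nat \<Rightarrow> real. x i = 0}" for i
    by (intro closed_Collect_eq continuous_intros continuous_on_product_coordinates)
  ultimately have "closed (Rn n)" by (auto intro: closed_INT)
  then show ?thesis by (rule borel_closed)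
qed

lemma log_concaveD:
  assumes "log_concave n \<mu>"
  shows "prob_space \<mu>" "sets \<mu> = sets borel" "space \<mu> = UNIV" "AE x in \<mu>. x \<in> Rn n"
    "S \<in> sets borel \<Longrightarrow> measure \<mu> (S \<inter> Rn n) = measure \<mu> S"
proof -
  show p: "prob_space \<mu>" and s: "sets \<mu> = sets borel" using assms by (auto simp: log_concave_def)
  then show "space \<mu> = UNIV" using sets_eq_imp_space_eq by fastforce
  interpret prob_space \<mu> by fact
  have "prob (Rn n) = 1" using assms by (simp add: log_concave_def measure_def)
  then show ae: "AE x in \<mu>. x \<in> Rn n" using prob_eq_1[of "Rn n"] s by auto
  show "measure \<mu> (S \<inter> Rn n) = measure \<mu> S" if "S \<in> sets borel"
    using ae s that by (intro finite_measure_eq_AE) auto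
qed

text \<open>Inner regularity of \<open>\<mu>\<close> carries the defining inequality from compact to
  Borel sets. \<open>C\<close> is any Borel set containing the combinations, as a Minkowski
  combination of Borel sets need not be Borel.\<close>

lemma log_concave_borel_sets:
  assumes lc: "log_concave n \<mu>" and A: "A \<in> sets borel" "A \<subseteq> Rn n" and B: "B \<in> sets borel" "B \<subseteq> Rn n"
    and C: "C \<in> sets borel" and t: "0 < t" "t < 1"
    and sub: "\<And>a b. a \<in> A \<Longrightarrow> b \<in> B \<Longrightarrow> (\<lambda>i. t * a i + (1 - t) * b i) \<in> C"
  shows "measure \<mu> A powr t * measure \<mu> B powr (1 - t) \<le> measure \<mu> C"
\<comment> \<open>A null factor makes the left side 0; otherwise both limits are nonzero and
  \<open>powr\<close> is continuous at them.\<close>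
proof (cases "measure \<mu> A = 0 \<or> measure \<mu> B = 0")
  case True
  then show ?thesis by auto
next
  case False
  note lcD = log_concaveD[OF lc]
  interpret prob_space \<mu> by (rule lcD(1))
  have approx: "\<exists>K. \<forall>k. compact (K k) \<and> K k \<subseteq> S \<and> measure \<mu> S - 1 / real (Suc k) < measure \<mu> (K k)"
    if S: "S \<in> sets borel" for S
  proof (rule choice, rule allI)
    fix k
    have reg: "emeasure \<mu> S = (SUP K \<in> {K. K \<subseteq> S \<and> compact K}. emeasure \<mu> K)"
      using lcD(2,3) S by (intro inner_regular) auto
    have lt: "ennreal (measure \<mu> S - 1 / real (Suc k)) < emeasure \<mu> S" if "measure \<mu> S \<noteq> 0"
    proof -
      have "0 < measure \<mu> S" using that by (simp add: zero_less_measure_iff)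
      then show ?thesis unfolding emeasure_eq_measure by (rule ennreal_lessI) simp
    qed
    have ex: "\<exists>K. compact K \<and> K \<subseteq> S \<and> ennreal (measure \<mu> S - 1 / real (Suc k)) < ennreal (measure \<mu> K)" if "measure \<mu> S \<noteq> 0"
      using lt[OF that] unfolding reg less_SUP_iff by (auto simp: emeasure_eq_measure)
    show "\<exists>K. compact K \<and> K \<subseteq> S \<and> measure \<mu> S - 1 / real (Suc k) < measure \<mu> K"
    proof (cases "measure \<mu> S = 0")
      case True
      then show ?thesis by (intro exI[of _ "{}"]) auto
    next
      case False
      then obtain K where K: "compact K" "K \<subseteq> S" "ennreal (measure \<mu> S - 1 / real (Suc k)) < ennreal (measure \<mu> K)"
        using ex by blast
      have "\<not> measure \<mu> K \<le> measure \<mu> S - 1 / real (Suc k)"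
      proof
        assume "measure \<mu> K \<le> measure \<mu> S - 1 / real (Suc k)"
        then have "ennreal (measure \<mu> K) \<le> ennreal (measure \<mu> S - 1 / real (Suc k))" by (rule ennreal_leI)
        with K(3) show False by simp
      qed
      with K(1,2) show ?thesis by (intro exI[of _ K]) (simp del: of_nat_Suc)
    qed
  qed
  from approx[OF A(1)] obtain K where K: "\<And>k. compact (K k)" "\<And>k. K k \<subseteq> A" "\<And>k. measure \<mu> A - 1 / real (Suc k) < measure \<mu> (K k)"
    by blast
  from approx[OF B(1)] obtain L where L: "\<And>k. compact (L k)" "\<And>k. L k \<subseteq> B" "\<And>k. measure \<mu> B - 1 / real (Suc k) < measure \<mu> (L k)"
    by blast
  have lim: "(\<lambda>k. measure \<mu> (K k)) \<longlonglongrightarrow> measure \<mu> S"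
    if "\<And>k. K k \<subseteq> S" "\<And>k. measure \<mu> S - 1 / real (Suc k) < measure \<mu> (K k)" "S \<in> sets borel" for K S
  proof (rule tendsto_sandwich)
    show "(\<lambda>k. measure \<mu> S - 1 / real (Suc k)) \<longlonglongrightarrow> measure \<mu> S"
      using tendsto_diff[OF tendsto_const LIMSEQ_inverse_real_of_nat, of "measure \<mu> S"]
      by (simp add: inverse_eq_divide)
    show "\<forall>\<^sub>F k in sequentially. measure \<mu> S - 1 / real (Suc k) \<le> measure \<mu> (K k)"
      using that by (intro always_eventually) (auto intro: less_imp_le)
    show "\<forall>\<^sub>F k in sequentially. measure \<mu> (K k) \<le> measure \<mu> S"
      using that lcD(2) by (intro always_eventually) (auto intro!: finite_measure_mono)
  qed (rule tendsto_const)
  have "(\<lambda>k. measure \<mu> (K k) powr t * measure \<mu> (L k) powr (1 - t)) \<longlonglongrightarrow> measure \<mu> A powr t * measure \<mu> B powr (1 - t)"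
    using lim[of K A] lim[of L B] K L A B False by (intro tendsto_intros) auto
  moreover have "measure \<mu> (K k) powr t * measure \<mu> (L k) powr (1 - t) \<le> measure \<mu> C" for k
  proof -
    have "measure \<mu> (K k) powr t * measure \<mu> (L k) powr (1 - t) \<le> measure \<mu> (mink_comb t (K k) (L k))"
    proof -
      have "K k \<subseteq> Rn n" "L k \<subseteq> Rn n" using K(2) L(2) A(2) B(2) by blast+
      then show ?thesis using lc K(1) L(1) t unfolding log_concave_def by simp
    qed
    also have "\<dots> \<le> measure \<mu> C"
      using K(2)[of k] L(2)[of k] sub C lcD(2) by (intro finite_measure_mono) (auto simp: mink_comb_def)
    finally show ?thesis .
  qed
  ultimately show ?thesis by (intro LIMSEQ_le_const2) auto
qed

text \<open>Layer-cake formula on a logarithmic scale. Writing levels as \<open>exp (- p)\<close>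
  turns a geometric mean of levels into an arithmetic mean of the parameters \<open>p\<close>, which
  is the shape of hypothesis in the inequality on the real line.\<close>

lemma nn_integral_exp_levels:
  assumes "sigma_finite_measure M" and [measurable]: "a \<in> borel_measurable M"
    and a: "\<And>x. 0 \<le> a x"
  shows "(\<integral>\<^sup>+x. ennreal (a x) \<partial>M) =
    (\<integral>\<^sup>+p. emeasure M {x \<in> space M. exp (- p) \<le> a x} * ennreal (exp (- p)) \<partial>lborel)"
proof -
  interpret sigma_finite_measure M by fact
  interpret P: pair_sigma_finite M lborel
    by (simp add: pair_sigma_finite_def lborel.sigma_finite_measure_axioms assms(1))
  have 1: "ennreal u = (\<integral>\<^sup>+p. ennreal (exp (- p)) * indicator {p. exp (- p) \<le> u} p \<partial>lborel)" if "0 \<le> u" for u :: real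
  proof (cases "u = 0")
    case False
    with that have u: "0 < u" by simp
    have "exp (- p) \<le> u \<longleftrightarrow> - ln u \<le> p" for p
      using u ln_ge_iff[of u "- p"] by linarith
    then have "(\<integral>\<^sup>+p. ennreal (exp (- p)) * indicator {p. exp (- p) \<le> u} p \<partial>lborel) =
      (\<integral>\<^sup>+p. ennreal (exp (- p)) * indicator {- ln u..} p \<partial>lborel)"
      by (intro nn_integral_cong) (auto simp: indicator_def)
    also have "\<dots> = ennreal (0 - (- exp (- (- ln u))))"
    proof (rule nn_integral_FTC_atLeast[where F="\<lambda>p. - exp (- p)"])
      have "((\<lambda>p::real. exp (- p)) \<longlongrightarrow> 0) at_top"
        by (rule filterlim_compose[OF exp_at_bot filterlim_uminus_at_bot_at_top])
      from tendsto_minus[OF this] show "((\<lambda>p::real. - exp (- p)) \<longlongrightarrow> 0) at_top" by simp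
    qed (auto intro!: derivative_eq_intros)
    finally show ?thesis using u by simp
  qed simp
  have "(\<integral>\<^sup>+x. ennreal (a x) \<partial>M) = (\<integral>\<^sup>+x. \<integral>\<^sup>+p. ennreal (exp (- p)) * indicator {(x, p). exp (- p) \<le> a x} (x, p) \<partial>lborel \<partial>M)"
    by (intro nn_integral_cong, subst 1) (auto intro!: nn_integral_cong simp: indicator_def a)
  also have "\<dots> = (\<integral>\<^sup>+p. \<integral>\<^sup>+x. ennreal (exp (- p)) * indicator {(x, p). exp (- p) \<le> a x} (x, p) \<partial>M \<partial>lborel)"
    by (rule P.Fubini'[symmetric]) measurable
  also have "\<dots> = (\<integral>\<^sup>+p. emeasure M {x \<in> space M. exp (- p) \<le> a x} * ennreal (exp (- p)) \<partial>lborel)"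
  proof (rule nn_integral_cong)
    fix p :: real
    have "(\<integral>\<^sup>+x. ennreal (exp (- p)) * indicator {(x, p). exp (- p) \<le> a x} (x, p) \<partial>M) =
      ennreal (exp (- p)) * (\<integral>\<^sup>+x. indicator {x \<in> space M. exp (- p) \<le> a x} x \<partial>M)"
      by (subst nn_integral_cmult[symmetric]) (auto intro!: nn_integral_cong simp: indicator_def)
    then show "(\<integral>\<^sup>+x. ennreal (exp (- p)) * indicator {(x, p). exp (- p) \<le> a x} (x, p) \<partial>M) =
      emeasure M {x \<in> space M. exp (- p) \<le> a x} * ennreal (exp (- p))" by (simp add: mult.commute)
  qed
  finally show ?thesis .
qed

text \<open>The superlevel sets at heights \<open>exp (- p)\<close>, \<open>exp (- q)\<close> and
  their geometric mean satisfy the log-concavity inequality of \<open>\<mu>\<close>. This says that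
  \<open>lev a\<close>, \<open>lev b\<close>, \<open>lev c\<close> satisfy the hypothesis of the
  inequality on the real line, whose integrals are those of \<open>a\<close>, \<open>b\<close>,
  \<open>c\<close>. The bound by 1 empties the levels with \<open>p < 0\<close> and so keeps
  \<open>lev\<close> bounded.\<close>

lemma log_concave_prekopa_leindler:
  assumes lc: "log_concave n \<mu>" and t: "0 < t" "t < 1"
    and [measurable]: "a \<in> borel_measurable borel" "b \<in> borel_measurable borel" "c \<in> borel_measurable borel"
    and a: "\<And>x. 0 \<le> a x" "\<And>x. a x \<le> 1" and b: "\<And>x. 0 \<le> b x" "\<And>x. b x \<le> 1" and c: "\<And>x. 0 \<le> c x" "\<And>x. c x \<le> 1"
    and le: "\<And>y z. y \<in> Rn n \<Longrightarrow> z \<in> Rn n \<Longrightarrow> a y powr t * b z powr (1 - t) \<le> c (\<lambda>i. t * y i + (1 - t) * z i)"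
  shows "(\<integral>x. a x \<partial>\<mu>) powr t * (\<integral>x. b x \<partial>\<mu>) powr (1 - t) \<le> (\<integral>x. c x \<partial>\<mu>)"
proof -
  note lcD = log_concaveD[OF lc]
  interpret prob_space \<mu> by (rule lcD(1))
  have [measurable_cong]: "sets \<mu> = sets borel" by (rule lcD(2))
  define lev where "lev u p = measure \<mu> {x. exp (- p) \<le> u x} * exp (- p)" for u :: "(nat \<Rightarrow> real) \<Rightarrow> real" and p
  have lev_int: "(\<integral>\<^sup>+p. ennreal (lev u p) \<partial>lborel) = ennreal (\<integral>x. u x \<partial>\<mu>)"
    if [measurable]: "u \<in> borel_measurable borel" and u: "\<And>x. 0 \<le> u x" "\<And>x. u x \<le> 1" for u
  proof -
    have "ennreal (\<integral>x. u x \<partial>\<mu>) = (\<integral>\<^sup>+x. ennreal (u x) \<partial>\<mu>)"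
      using u by (intro nn_integral_eq_integral[symmetric] integrable_const_bound[where B=1]) (auto simp: abs_le_iff)
    also have "\<dots> = (\<integral>\<^sup>+p. emeasure \<mu> {x \<in> space \<mu>. exp (- p) \<le> u x} * ennreal (exp (- p)) \<partial>lborel)"
      using u by (intro nn_integral_exp_levels sigma_finite_measure_axioms) auto
    also have "\<dots> = (\<integral>\<^sup>+p. ennreal (lev u p) \<partial>lborel)"
      by (intro nn_integral_cong) (simp add: lev_def emeasure_eq_measure lcD(3) ennreal_mult)
    finally show ?thesis by simp
  qed
  have lev_meas: "lev u \<in> borel_measurable borel" if [measurable]: "u \<in> borel_measurable borel" for u
  proof -
    \<comment> \<open>Superlevel sets grow with \<open>p\<close>, and monotone functions are
      measurable.\<close>
    have "mono (\<lambda>p. measure \<mu> {x. exp (- p) \<le> u x})"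
    proof (intro monoI finite_measure_mono subsetI)
      fix p q :: real and x assume "p \<le> q" and x: "x \<in> {x. exp (- p) \<le> u x}"
      then have "exp (- q) \<le> exp (- p)" by simp
      also have "\<dots> \<le> u x" using x by simp
      finally show "x \<in> {x. exp (- q) \<le> u x}" by simp
    qed (simp add: lcD(2))
    then have [measurable]: "(\<lambda>p. measure \<mu> {x. exp (- p) \<le> u x}) \<in> borel_measurable borel"
      by (rule borel_measurable_mono)
    show ?thesis unfolding lev_def by measurable
  qed
  have lev_bdd: "bdd_above (range (lev u))" if u: "\<And>x. u x \<le> 1" for u
  proof (intro bdd_aboveI[of _ 1], clarify)
    fix p
    show "lev u p \<le> 1"
    proof (cases "exp (- p) \<le> 1")
      case True
      then show ?thesis unfolding lev_def by (intro mult_le_one) auto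
    next
      case False
      have "\<not> exp (- p) \<le> u x" for x using u[of x] False by linarith
      then have "{x. exp (- p) \<le> u x} = {}" by blast
      then show ?thesis by (simp add: lev_def)
    qed
  qed
  have lev_nonneg: "0 \<le> lev u p" for u p by (simp add: lev_def)
  have key: "lev a p powr t * lev b q powr (1 - t) \<le> lev c (t * p + (1 - t) * q)" for p q
  proof -
    let ?A = "{x. exp (- p) \<le> a x} \<inter> Rn n" and ?B = "{x. exp (- q) \<le> b x} \<inter> Rn n"
    let ?C = "{x. exp (- (t * p + (1 - t) * q)) \<le> c x}"
    have e: "exp (- (t * p + (1 - t) * q)) = exp (- p) powr t * exp (- q) powr (1 - t)"
      by (simp add: powr_def exp_add[symmetric] algebra_simps)
    have "measure \<mu> ?A powr t * measure \<mu> ?B powr (1 - t) \<le> measure \<mu> ?C"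
    proof (rule log_concave_borel_sets[OF lc _ _ _ _ _ t])
      fix y z assume yz: "y \<in> ?A" "z \<in> ?B"
      have "exp (- p) powr t * exp (- q) powr (1 - t) \<le> a y powr t * b z powr (1 - t)"
        using yz t by (intro mult_mono powr_mono2) auto
      also have "\<dots> \<le> c (\<lambda>i. t * y i + (1 - t) * z i)" using yz le by auto
      finally show "(\<lambda>i. t * y i + (1 - t) * z i) \<in> ?C" unfolding e[symmetric] by blast
    qed auto
    then have "measure \<mu> {x. exp (- p) \<le> a x} powr t * measure \<mu> {x. exp (- q) \<le> b x} powr (1 - t) \<le> measure \<mu> ?C"
      by (simp add: lcD(5))
    then have "(measure \<mu> {x. exp (- p) \<le> a x} powr t * measure \<mu> {x. exp (- q) \<le> b x} powr (1 - t)) * (exp (- p) powr t * exp (- q) powr (1 - t))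
      \<le> measure \<mu> ?C * exp (- (t * p + (1 - t) * q))"
      unfolding e by (intro mult_right_mono) auto
    also have "(measure \<mu> {x. exp (- p) \<le> a x} powr t * measure \<mu> {x. exp (- q) \<le> b x} powr (1 - t)) * (exp (- p) powr t * exp (- q) powr (1 - t)) =
      lev a p powr t * lev b q powr (1 - t)"
      unfolding lev_def by (simp only: powr_mult mult_ac)
    finally show ?thesis unfolding lev_def .
  qed
  have int_nonneg: "0 \<le> (\<integral>x. u x \<partial>\<mu>)" if "\<And>x. 0 \<le> u x" for u :: "_ \<Rightarrow> real"
    using that by (simp add: integral_nonneg_AE)
  show ?thesis
    by (rule prekopa_leindler_real[OF lev_meas lev_meas lev_meas lev_nonneg lev_nonneg lev_nonneg
          lev_bdd lev_bdd t key lev_int int_nonneg lev_int int_nonneg lev_int int_nonneg])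
      (fact a b c assms(4-6))+
qed

section \<open>Second moments\<close>

text \<open>Dividing the hypothesis by \<open>y\<close> gives the \<open>k\<close>-th root of
  \<open>x / y\<close> on the left, and \<open>y \<le> 1\<close> yields
  \<open>x \<le> x / y\<close>.\<close>

lemma le_power_if_powr_mean_le:
  fixes x y z :: real
  assumes x: "0 \<le> x" and y: "0 < y" "y \<le> 1" and k: "0 < k"
    and le: "x powr (1 / real k) * y powr (1 - 1 / real k) \<le> z"
  shows "x \<le> (z / y) ^ k"
proof (cases "x = 0")
  case True
  then have "0 \<le> z" using le by simp
  then show ?thesis using True y by simp
next
  case False
  with x have x0: "0 < x" by simp
  have "(x / y) powr (1 / real k) = x powr (1 / real k) * y powr (1 - 1 / real k) / y"
    using x0 y by (simp add: powr_divide powr_diff)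
  also have "\<dots> \<le> z / y" using le y by (simp add: divide_right_mono)
  finally have "((x / y) powr (1 / real k)) ^ k \<le> (z / y) ^ k" by (intro power_mono) auto
  moreover have "((x / y) powr (1 / real k)) ^ k = x / y"
    using x0 y k by (simp add: powr_realpow[symmetric] powr_powr)
  moreover have "x \<le> x / y" using x0 y by (simp add: le_divide_eq mult_left_le)
  ultimately show ?thesis by simp
qed

text \<open>The level \<open>s\<close> is the mean of the levels \<open>k * s\<close> and 0 with
  weights \<open>1 / k\<close> and \<open>1 - 1 / k\<close>, so log-concavity compares three
  parallel half-spaces and gives geometric decay with ratio \<open>p s / p 0\<close>. The factor
  \<open>c\<close> covers both tails through its sign.\<close>

lemma log_concave_tail_decay:
  assumes lc: "log_concave n \<mu>"
  obtains s r where "0 < s" "0 \<le> r" "r < 1" "\<And>k::nat. measure \<mu> {x. real k * s \<le> c * x i} \<le> r ^ k"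
proof -
  note lcD = log_concaveD[OF lc]
  interpret prob_space \<mu> by (rule lcD(1))
  note [measurable_cong] = lcD(2)
  define p where "p s = measure \<mu> {x. s \<le> c * x i}" for s
  have [measurable]: "{x :: nat \<Rightarrow> real. s \<le> c * x i} \<in> sets borel" for s by measurable
  have "(\<lambda>k. measure \<mu> {x. real k \<le> c * x i}) \<longlonglongrightarrow> measure \<mu> (\<Inter>k. {x. real k \<le> c * x i})"
    by (rule finite_Lim_measure_decseq) (auto simp: lcD(2) decseq_def)
  also have "(\<Inter>k. {x :: nat \<Rightarrow> real. real k \<le> c * x i}) = {}"
  proof -
    have "\<exists>k::nat. \<not> real k \<le> c * x i" for x :: "nat \<Rightarrow> real" using reals_Archimedean2[of "c * x i"] by (auto simp: not_le)
    then show ?thesis by blast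
  qed
  finally have lim: "(\<lambda>k. p (real k)) \<longlonglongrightarrow> 0" by (simp add: p_def)
  show ?thesis
  proof (cases "p 0 = 0")
    case True
    have "p (real k * 1) \<le> 0 ^ k" for k :: nat
    proof -
      have "p (real k * 1) \<le> p 0"
        unfolding p_def by (intro finite_measure_mono) (auto simp: lcD(2))
      also have "\<dots> \<le> 0 ^ k" unfolding True by simp
      finally show ?thesis .
    qed
    then show ?thesis by (intro that[of 1 0]) (auto simp: p_def)
  next
    case False
    then have p0: "0 < p 0" by (simp add: p_def zero_less_measure_iff)
    have p01: "p 0 \<le> 1" by (simp add: p_def)
    from order_tendstoD(2)[OF lim p0] obtain k0 where k0: "p (real k0) < p 0"
      by (auto simp: eventually_sequentially)
    define s where "s = real k0"
    have s: "0 < s" using k0 by (cases "k0 = 0") (auto simp: s_def)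
    define r where "r = p s / p 0"
    have r: "0 \<le> r" "r < 1" using k0 p0 by (auto simp: r_def s_def p_def)
    have "p (real k * s) \<le> r ^ k" if k: "2 \<le> k" for k :: nat
    proof -
      define t where "t = 1 / real k"
      have t: "0 < t" "t < 1" "t * real k = 1" using k by (auto simp: t_def)
      have "measure \<mu> ({x. real k * s \<le> c * x i} \<inter> Rn n) powr t * measure \<mu> ({x. 0 \<le> c * x i} \<inter> Rn n) powr (1 - t)
          \<le> measure \<mu> {x. s \<le> c * x i}"
      proof (rule log_concave_borel_sets[OF lc _ _ _ _ _ t(1,2)])
        fix a b assume "a \<in> {x. real k * s \<le> c * x i} \<inter> Rn n" "b \<in> {x. 0 \<le> c * x i} \<inter> Rn n"
        then have "real k * s \<le> c * a i" "0 \<le> c * b i" by auto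
        then have "t * (real k * s) + 0 \<le> t * (c * a i) + (1 - t) * (c * b i)"
          using t by (intro add_mono mult_left_mono mult_nonneg_nonneg[of "1 - t" "c * b i"]) auto
        moreover have "t * (real k * s) = s" using t(3) by (simp add: mult.assoc[symmetric])
        ultimately have "s \<le> t * (c * a i) + (1 - t) * (c * b i)" by linarith
        then show "(\<lambda>i. t * a i + (1 - t) * b i) \<in> {x. s \<le> c * x i}" by (simp add: algebra_simps)
      qed auto
      then have "p (real k * s) powr (1 / real k) * p 0 powr (1 - 1 / real k) \<le> p s"
        by (simp add: lcD(5) p_def t_def)
      then show ?thesis unfolding r_def
        using k p0 p01 by (intro le_power_if_powr_mean_le) (auto simp: p_def)
    qed
    \<comment> \<open>For \<open>k < 2\<close> the weight \<open>1 / k\<close> is not in (0,1);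
      these cases follow from \<open>p 0 \<le> 1\<close>.\<close>
    moreover have "p (real k * s) \<le> r ^ k" if "k = 0 \<or> k = 1" for k
      using that p0 p01 by (auto simp: r_def p_def le_divide_eq mult_left_le)
    ultimately have "p (real k * s) \<le> r ^ k" for k
      by (cases "2 \<le> k") (auto simp: not_le numeral_2_eq_2 less_Suc_eq)
    then show ?thesis using s r by (intro that[of s r]) (auto simp: p_def)
  qed
qed

lemma log_concave_square_integrable:
  assumes lc: "log_concave n \<mu>"
  shows "integrable \<mu> (\<lambda>x. (x i)\<^sup>2)"
proof -
  note lcD = log_concaveD[OF lc]
  interpret prob_space \<mu> by (rule lcD(1))
  note [measurable_cong] = lcD(2)
  have half: "(\<integral>\<^sup>+x. ennreal ((max 0 (c * x i))\<^sup>2) \<partial>\<mu>) < \<infinity>" for c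
  proof -
    obtain s r where s: "0 < s" and r: "0 \<le> r" "r < 1"
      and decay: "\<And>k::nat. measure \<mu> {x. real k * s \<le> c * x i} \<le> r ^ k"
      using log_concave_tail_decay[OF lc] by blast
    \<comment> \<open>The first \<open>K + 1\<close> odd numbers sum to the square of
      \<open>K + 1\<close>, so these indicators add up to a step function above the squared positive
      part. By the tail decay its integral is at most a convergent series with terms of order
      \<open>(k + 1) * r ^ k\<close>.\<close>
    let ?g = "\<lambda>k x. ennreal (s\<^sup>2 * (2 * real k + 1)) * indicator {x. real k * s \<le> c * x i} x"
    have pt: "ennreal ((max 0 (c * x i))\<^sup>2) \<le> (\<Sum>k. ?g k x)" for x
    proof (cases "0 \<le> c * x i")
      case True
      define K where "K = nat \<lfloor>c * x i / s\<rfloor>"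
      have K: "real K * s \<le> c * x i" "c * x i \<le> real (Suc K) * s"
      proof -
        have "real K = of_int \<lfloor>c * x i / s\<rfloor>" using True s by (simp add: K_def)
        then have "real K \<le> c * x i / s" "c * x i / s \<le> real (Suc K)"
          using floor_correct[of "c * x i / s"] by linarith+
        then show "real K * s \<le> c * x i" "c * x i \<le> real (Suc K) * s"
          using s by (simp_all add: le_divide_eq divide_le_eq)
      qed
      have odd: "(\<Sum>k<m. 2 * real k + 1) = (real m)\<^sup>2" for m
        by (induction m) (auto simp: power2_eq_square algebra_simps)
      have "(max 0 (c * x i))\<^sup>2 \<le> (real (Suc K) * s)\<^sup>2"
        using True K by (intro power_mono) auto
      also have "\<dots> = s\<^sup>2 * (\<Sum>k<Suc K. 2 * real k + 1)"
        unfolding odd by (simp add: power_mult_distrib mult.commute)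
      finally have "ennreal ((max 0 (c * x i))\<^sup>2) \<le> ennreal (\<Sum>k<Suc K. s\<^sup>2 * (2 * real k + 1))"
        by (intro ennreal_leI) (simp only: sum_distrib_left)
      also have "\<dots> = (\<Sum>k<Suc K. ennreal (s\<^sup>2 * (2 * real k + 1)))"
        by (subst sum_ennreal) auto
      also have "\<dots> = (\<Sum>k<Suc K. ?g k x)"
      proof (rule sum.cong)
        fix k assume "k \<in> {..<Suc K}"
        then have "real k * s \<le> real K * s" using s by (intro mult_right_mono) auto
        then show "ennreal (s\<^sup>2 * (2 * real k + 1)) = ?g k x" using K(1) by (simp add: indicator_def)
      qed simp
      also have "\<dots> \<le> (\<Sum>k. ?g k x)" by (rule sum_le_suminf) auto
      finally show ?thesis .
    qed simp
    have "(\<integral>\<^sup>+x. ennreal ((max 0 (c * x i))\<^sup>2) \<partial>\<mu>) \<le> (\<integral>\<^sup>+x. (\<Sum>k. ?g k x) \<partial>\<mu>)"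
      by (intro nn_integral_mono pt)
    also have "\<dots> = (\<Sum>k. \<integral>\<^sup>+x. ?g k x \<partial>\<mu>)" by (rule nn_integral_suminf) measurable
    also have "\<dots> \<le> (\<Sum>k. ennreal (2 * s\<^sup>2 * (real (Suc k) * r ^ k)))"
    proof (rule suminf_le)
      fix k
      have "(\<integral>\<^sup>+x. ?g k x \<partial>\<mu>) = ennreal (s\<^sup>2 * (2 * real k + 1)) * ennreal (measure \<mu> {x. real k * s \<le> c * x i})"
        by (subst nn_integral_cmult_indicator) (auto simp: emeasure_eq_measure lcD(2))
      also have "\<dots> = ennreal (s\<^sup>2 * (2 * real k + 1) * measure \<mu> {x. real k * s \<le> c * x i})"
        by (subst ennreal_mult) auto
      also have "\<dots> \<le> ennreal (s\<^sup>2 * (2 * real (Suc k)) * r ^ k)"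
        using decay[of k] r by (intro ennreal_leI mult_mono) auto
      also have "s\<^sup>2 * (2 * real (Suc k)) * r ^ k = 2 * s\<^sup>2 * (real (Suc k) * r ^ k)" by (simp only: mult_ac)
      finally show "(\<integral>\<^sup>+x. ?g k x \<partial>\<mu>) \<le> ennreal (2 * s\<^sup>2 * (real (Suc k) * r ^ k))" .
    qed auto
    also have "\<dots> < \<infinity>"
    proof -
      have "summable (\<lambda>k. 2 * s\<^sup>2 * (real (Suc k) * r ^ k))"
        using geometric_deriv_sums[of r] r by (intro summable_mult) (auto simp: sums_iff)
      then show ?thesis using r by (subst suminf_ennreal2) auto
    qed
    finally show ?thesis .
  qed
  show ?thesis
  proof (rule integrableI_bounded)
    have "ennreal (norm ((x i)\<^sup>2)) = ennreal ((max 0 (1 * x i))\<^sup>2) + ennreal ((max 0 (- 1 * x i))\<^sup>2)" for x :: "nat \<Rightarrow> real"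
      by (subst ennreal_plus[symmetric]) (auto simp: max_def)
    then have "(\<integral>\<^sup>+x. ennreal (norm ((x i)\<^sup>2)) \<partial>\<mu>) = (\<integral>\<^sup>+x. ennreal ((max 0 (1 * x i))\<^sup>2) \<partial>\<mu>) + (\<integral>\<^sup>+x. ennreal ((max 0 (- 1 * x i))\<^sup>2) \<partial>\<mu>)"
      by (subst nn_integral_add[symmetric]) auto
    then show "(\<integral>\<^sup>+x. ennreal (norm ((x i)\<^sup>2)) \<partial>\<mu>) < \<infinity>" using half[of 1] half[of "- 1"] by simp
  qed measurable
qed

lemma log_concave_product_integrable:
  assumes lc: "log_concave n \<mu>"
  shows "integrable \<mu> (\<lambda>x. x i * x j)"
proof (rule Bochner_Integration.integrable_bound)
  show "integrable \<mu> (\<lambda>x. (x i)\<^sup>2 + (x j)\<^sup>2)"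
    by (intro Bochner_Integration.integrable_add log_concave_square_integrable[OF lc])
  show "(\<lambda>x. x i * x j) \<in> borel_measurable \<mu>"
    unfolding measurable_cong_sets[OF log_concaveD(2)[OF lc] refl] by measurable
  have "\<bar>a * b\<bar> \<le> a\<^sup>2 + b\<^sup>2" for a b :: real
  proof -
    have "2 * (\<bar>a\<bar> * \<bar>b\<bar>) \<le> a\<^sup>2 + b\<^sup>2" using sum_squares_bound[of "\<bar>a\<bar>" "\<bar>b\<bar>"] by (simp add: mult.assoc)
    moreover have "0 \<le> \<bar>a\<bar> * \<bar>b\<bar>" by simp
    ultimately show ?thesis unfolding abs_mult by linarith
  qed
  then show "AE x in \<mu>. norm (x i * x j) \<le> norm ((x i)\<^sup>2 + (x j)\<^sup>2)" by simp
qed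

section \<open>Lebesgue measure on the coordinate model\<close>

lemma sets_lebn [simp, measurable_cong]: "sets (lebn n) = sets borel"
  and space_lebn [simp]: "space (lebn n) = UNIV"
  by (simp_all add: lebn_def)

lemma measurable_pad: "(\<lambda>x (i::nat). if i < n then x i else 0) \<in> measurable (PiM {..<n} (\<lambda>_. lborel :: real measure)) borel"
proof (rule measurable_coordinatewise_then_product)
  fix i
  show "(\<lambda>x. if i < n then x i else 0) \<in> borel_measurable (PiM {..<n} (\<lambda>_. lborel :: real measure))"
    by (cases "i < n") auto
qed

lemma measurable_fun_upd_pair [measurable]:
  "(\<lambda>(x, u). x(n := u)) \<in> measurable (borel \<Otimes>\<^sub>M borel) (borel :: (nat \<Rightarrow> real) measure)"
proof (rule measurable_coordinatewise_then_product)
  fix i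
  show "(\<lambda>p. (case p of (x, u) \<Rightarrow> x(n := u)) i) \<in> borel_measurable (borel \<Otimes>\<^sub>M (borel :: real measure))"
    by (cases "i = n") (simp_all add: case_prod_unfold measurable_product_then_coordinatewise)
qed

lemma measurable_fun_upd:
  "(\<lambda>u. x(n := u)) \<in> measurable borel (borel :: (nat \<Rightarrow> real) measure)"
  by (rule measurable_coordinatewise_then_product) (simp add: fun_upd_def)

lemma nn_integral_lebn_0:
  assumes "g \<in> borel_measurable borel"
  shows "(\<integral>\<^sup>+x. g x \<partial>lebn 0) = g (\<lambda>_. 0)"
proof -
  interpret product_sigma_finite "\<lambda>_ :: nat. lborel :: real measure" by standard
  show ?thesis
    unfolding lebn_def using assms
    by (subst nn_integral_distr[OF measurable_pad]) (simp_all add: nn_integral_empty del: nn_integral_const)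
qed

text \<open>Tonelli with the last coordinate split off; this drives the inductions on the
  dimension.\<close>

lemma nn_integral_lebn_Suc:
  assumes g [measurable]: "g \<in> borel_measurable borel"
  shows "(\<integral>\<^sup>+x. g x \<partial>lebn (Suc n)) = (\<integral>\<^sup>+x. \<integral>\<^sup>+u. g (x(n := u)) \<partial>lborel \<partial>lebn n)"
proof -
  interpret product_sigma_finite "\<lambda>_ :: nat. lborel :: real measure" by standard
  let ?e = "\<lambda>n (x :: nat \<Rightarrow> real) i. if i < n then x i else 0"
  have m: "(\<lambda>x. \<integral>\<^sup>+u. g (x(n := u)) \<partial>lborel) \<in> borel_measurable borel"
    by measurable
  have "(\<integral>\<^sup>+x. g x \<partial>lebn (Suc n)) = (\<integral>\<^sup>+x. g (?e (Suc n) x) \<partial>PiM (insert n {..<n}) (\<lambda>_. lborel))"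
    unfolding lebn_def by (subst nn_integral_distr[OF measurable_pad]) (simp_all add: lessThan_Suc)
  also have "\<dots> = (\<integral>\<^sup>+x. \<integral>\<^sup>+u. g (?e (Suc n) (x(n := u))) \<partial>lborel \<partial>PiM {..<n} (\<lambda>_. lborel))"
    using measurable_compose[OF measurable_pad g, of "Suc n"]
    by (intro product_nn_integral_insert) (simp_all add: lessThan_Suc)
  also have "\<dots> = (\<integral>\<^sup>+x. \<integral>\<^sup>+u. g ((?e n x)(n := u)) \<partial>lborel \<partial>PiM {..<n} (\<lambda>_. lborel))"
    by (intro nn_integral_cong arg_cong[where f=g]) auto
  also have "\<dots> = (\<integral>\<^sup>+x. \<integral>\<^sup>+u. g (x(n := u)) \<partial>lborel \<partial>lebn n)"
    unfolding lebn_def using m by (subst nn_integral_distr[OF measurable_pad]) simp_all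
  finally show ?thesis .
qed

lemma AE_lebn_Rn: "AE x in lebn n. x \<in> Rn n"
  unfolding lebn_def by (subst AE_distr_iff[OF measurable_pad]) (auto simp: Rn_def[symmetric], simp add: Rn_def)

lemma measurable_affine:
  "(\<lambda>x i. z i + c * x i) \<in> measurable borel (borel :: (nat \<Rightarrow> real) measure)"
  by (rule measurable_coordinatewise_then_product) simp

text \<open>Induction on the dimension, with the one-dimensional affine substitution in the last
  coordinate contributing one factor \<open>\<bar>c\<bar>\<close> each time.\<close>

lemma nn_integral_lebn_affine:
  assumes "g \<in> borel_measurable borel" and c: "c \<noteq> 0" and "z \<in> Rn n"
  shows "(\<integral>\<^sup>+x. g x \<partial>lebn n) = ennreal (\<bar>c\<bar> ^ n) * (\<integral>\<^sup>+x. g (\<lambda>i. z i + c * x i) \<partial>lebn n)"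
  using assms(1,3)
proof (induction n arbitrary: g z)
  case 0
  then have "z = (\<lambda>_. 0)" by (auto simp: Rn_def)
  then have "(\<integral>\<^sup>+x. g (\<lambda>i. z i + c * x i) \<partial>lebn 0) = g (\<lambda>_. 0)"
    using measurable_compose[OF measurable_affine 0(1), of z c] by (subst nn_integral_lebn_0) auto
  then show ?case by (simp add: nn_integral_lebn_0 0)
next
  case (Suc n)
  note [measurable] = Suc.prems(1)
  define z' where "z' = z(n := 0)"
  have z': "z' \<in> Rn n" using Suc.prems(2) by (auto simp: z'_def Rn_def le_Suc_eq)
  have eq: "(\<lambda>i. z i + c * (x(n := u)) i) = (\<lambda>i. z' i + c * x i)(n := z n + c * u)" for x u
    by (auto simp: z'_def)
  define g' where "g' x = (\<integral>\<^sup>+u. g (x(n := u)) \<partial>lborel)" for x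
  have g' [measurable]: "g' \<in> borel_measurable borel" unfolding g'_def by measurable
  have gz [measurable]: "(\<lambda>x. g (\<lambda>i. z i + c * x i)) \<in> borel_measurable borel"
    by (rule measurable_compose[OF measurable_affine Suc.prems(1)])
  have "(\<integral>\<^sup>+x. g x \<partial>lebn (Suc n)) = (\<integral>\<^sup>+x. g' x \<partial>lebn n)"
    unfolding g'_def by (rule nn_integral_lebn_Suc) fact
  also have "\<dots> = ennreal (\<bar>c\<bar> ^ n) * (\<integral>\<^sup>+x. g' (\<lambda>i. z' i + c * x i) \<partial>lebn n)"
    by (rule Suc.IH[OF g' z'])
  also have "(\<integral>\<^sup>+x. g' (\<lambda>i. z' i + c * x i) \<partial>lebn n) =
      (\<integral>\<^sup>+x. ennreal \<bar>c\<bar> * (\<integral>\<^sup>+u. g (\<lambda>i. z i + c * (x(n := u)) i) \<partial>lborel) \<partial>lebn n)"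
  proof (rule nn_integral_cong)
    fix x
    have "g' (\<lambda>i. z' i + c * x i) = ennreal \<bar>c\<bar> * (\<integral>\<^sup>+u. g ((\<lambda>i. z' i + c * x i)(n := z n + c * u)) \<partial>lborel)"
      unfolding g'_def using c
      by (intro nn_integral_real_affine measurable_compose[OF measurable_fun_upd Suc.prems(1)])
    then show "g' (\<lambda>i. z' i + c * x i) = ennreal \<bar>c\<bar> * (\<integral>\<^sup>+u. g (\<lambda>i. z i + c * (x(n := u)) i) \<partial>lborel)"
      by (simp only: eq)
  qed
  also have "\<dots> = ennreal \<bar>c\<bar> * (\<integral>\<^sup>+x. (\<integral>\<^sup>+u. g (\<lambda>i. z i + c * (x(n := u)) i) \<partial>lborel) \<partial>lebn n)"
    using measurable_compose[OF measurable_fun_upd_pair gz]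
    by (intro nn_integral_cmult) (simp add: case_prod_unfold)
  also have "(\<integral>\<^sup>+x. (\<integral>\<^sup>+u. g (\<lambda>i. z i + c * (x(n := u)) i) \<partial>lborel) \<partial>lebn n) = (\<integral>\<^sup>+x. g (\<lambda>i. z i + c * x i) \<partial>lebn (Suc n))"
    by (rule nn_integral_lebn_Suc[symmetric, OF gz])
  finally show ?case by (simp add: ennreal_mult mult_ac)
qed

section \<open>Gaussian integrals and sigma-finiteness\<close>

lemma nn_integral_gaussian_real:
  assumes d: "0 < d"
  shows "(\<integral>\<^sup>+u. ennreal (exp (- (u + a)\<^sup>2 / d)) \<partial>lborel) = ennreal (sqrt (pi * d))"
proof -
  define s where "s = sqrt (d / 2)"
  have s: "0 < s" "2 * s\<^sup>2 = d" using d by (auto simp: s_def)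
  have "(\<integral>\<^sup>+u. ennreal (normal_density (- a) s u) \<partial>lborel) = 1"
    using s by (subst nn_integral_eq_integral) (auto simp: integral_normal_density)
  moreover have "ennreal (exp (- (u + a)\<^sup>2 / d)) = ennreal (sqrt (pi * d)) * ennreal (normal_density (- a) s u)" for u
  proof -
    have *: "2 * pi * s\<^sup>2 = pi * d" using s(2) by simp
    have "sqrt (pi * d) * normal_density (- a) s u = exp (- (u + a)\<^sup>2 / d)"
      unfolding normal_density_def s(2) * using d by simp
    then show ?thesis by (metis ennreal_mult' normal_density_nonneg mult.commute)
  qed
  ultimately show ?thesis by (simp add: nn_integral_cmult)
qed

text \<open>By hypothesis \<open>l j\<close> depends only on coordinates below \<open>j\<close>.
  Integrating the last coordinate first leaves a one-dimensional Gaussian whose integral does not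
  depend on its centre, which replaces a triangular change of variables.\<close>

lemma nn_integral_gaussian_lebn:
  fixes d :: "nat \<Rightarrow> real" and l :: "nat \<Rightarrow> (nat \<Rightarrow> real) \<Rightarrow> real"
  assumes d: "\<And>j. 0 < d j" and [measurable]: "\<And>j. l j \<in> borel_measurable borel"
    and l: "\<And>j k x u. j \<le> k \<Longrightarrow> l j (x(k := u)) = l j x"
  shows "(\<integral>\<^sup>+x. ennreal (exp (- (\<Sum>j<n. (x j + l j x)\<^sup>2 / d j))) \<partial>lebn n) = ennreal (\<Prod>j<n. sqrt (pi * d j))"
proof (induction n)
  case 0
  then show ?case by (subst nn_integral_lebn_0) auto
next
  case (Suc n)
  have "(\<integral>\<^sup>+x. ennreal (exp (- (\<Sum>j<Suc n. (x j + l j x)\<^sup>2 / d j))) \<partial>lebn (Suc n)) =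
    (\<integral>\<^sup>+x. \<integral>\<^sup>+u. ennreal (exp (- (\<Sum>j<Suc n. ((x(n := u)) j + l j (x(n := u)))\<^sup>2 / d j))) \<partial>lborel \<partial>lebn n)"
    by (rule nn_integral_lebn_Suc) measurable
  also have "\<dots> = (\<integral>\<^sup>+x. ennreal (exp (- (\<Sum>j<n. (x j + l j x)\<^sup>2 / d j))) * ennreal (sqrt (pi * d n)) \<partial>lebn n)"
  proof (rule nn_integral_cong)
    fix x :: "nat \<Rightarrow> real"
    have "ennreal (exp (- (\<Sum>j<Suc n. ((x(n := u)) j + l j (x(n := u)))\<^sup>2 / d j))) =
      ennreal (exp (- (\<Sum>j<n. (x j + l j x)\<^sup>2 / d j))) * ennreal (exp (- (u + l n x)\<^sup>2 / d n))" for u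
      by (subst ennreal_mult[symmetric]) (auto simp: l exp_add[symmetric])
    then show "(\<integral>\<^sup>+u. ennreal (exp (- (\<Sum>j<Suc n. ((x(n := u)) j + l j (x(n := u)))\<^sup>2 / d j))) \<partial>lborel) =
      ennreal (exp (- (\<Sum>j<n. (x j + l j x)\<^sup>2 / d j))) * ennreal (sqrt (pi * d n))"
      using nn_integral_gaussian_real[OF d[of n], of "l n x"] by (simp add: nn_integral_cmult)
  qed
  also have "\<dots> = ennreal (\<Prod>j<n. sqrt (pi * d j)) * ennreal (sqrt (pi * d n))"
    by (subst nn_integral_multc) (simp_all add: Suc)
  also have "\<dots> = ennreal (\<Prod>j<Suc n. sqrt (pi * d j))"
    by (simp add: ennreal_mult[symmetric] prod_nonneg d less_imp_le)
  finally show ?case .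
qed

text \<open>Superlevel sets of a Gaussian have finite measure by Markov's inequality and exhaust the
  space because the Gaussian is positive everywhere.\<close>

lemma sigma_finite_lebn: "sigma_finite_measure (lebn n)"
proof
  define h where "h x = ennreal (exp (- (\<Sum>j<n. (x j :: real)\<^sup>2)))" for x
  have [measurable]: "h \<in> borel_measurable borel" unfolding h_def by measurable
  have int: "(\<integral>\<^sup>+x. h x \<partial>lebn n) < \<infinity>"
    using nn_integral_gaussian_lebn[of "\<lambda>_. 1" "\<lambda>_ _. 0" n] by (simp add: h_def)
  let ?A = "\<lambda>k::nat. {x. 1 \<le> of_nat k * h x}"
  have "emeasure (lebn n) (?A k) \<noteq> \<infinity>" for k
  proof -
    have "emeasure (lebn n) ({x\<in>UNIV. 1 \<le> of_nat k * h x}) \<le> of_nat k * (\<integral>\<^sup>+x. h x * indicator UNIV x \<partial>lebn n)"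
      by (rule nn_integral_Markov_inequality) measurable
    also have "\<dots> < \<infinity>" using int by (simp add: ennreal_mult_less_top of_nat_less_top)
    finally show ?thesis by simp
  qed
  moreover have "(\<Union>k. ?A k) = UNIV"
  proof -
    have "\<exists>k::nat. 1 \<le> of_nat k * h x" for x
    proof -
      obtain k :: nat where "1 / exp (- (\<Sum>j<n. (x j)\<^sup>2)) \<le> real k" using real_arch_simple by blast
      then have "1 \<le> real k * exp (- (\<Sum>j<n. (x j)\<^sup>2))" by (simp add: divide_le_eq)
      then have "ennreal 1 \<le> ennreal (real k * exp (- (\<Sum>j<n. (x j)\<^sup>2)))" by (rule ennreal_leI)
      then show ?thesis by (intro exI[of _ k]) (simp add: h_def ennreal_mult ennreal_of_nat_eq_real_of_nat)
    qed
    then show ?thesis by auto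
  qed
  ultimately show "\<exists>A. countable A \<and> A \<subseteq> sets (lebn n) \<and> \<Union> A = space (lebn n) \<and> (\<forall>a\<in>A. emeasure (lebn n) a \<noteq> \<infinity>)"
    by (intro exI[of _ "range ?A"]) auto
qed

section \<open>Iterated convolutions of a Gaussian\<close>

text \<open>Convolution with \<open>\<mu>\<close>: if \<open>f\<close> is proportional to a density,
  this is proportional to the density after adding an independent point of law
  \<open>\<mu>\<close>.\<close>

definition smear :: "(nat \<Rightarrow> real) measure \<Rightarrow> ((nat \<Rightarrow> real) \<Rightarrow> real) \<Rightarrow> (nat \<Rightarrow> real) \<Rightarrow> real" where
  "smear \<mu> f x = (\<integral>z. f (\<lambda>i. x i - z i) \<partial>\<mu>)"

text \<open>Continuity provides measurability and closed superlevel sets, and values in [0,1] are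
  what the Prekopa-Leindler inequality for \<open>\<mu>\<close> asks for; convolution with
  \<open>\<mu>\<close> preserves both.\<close>

definition log_concave_fun :: "((nat \<Rightarrow> real) \<Rightarrow> real) \<Rightarrow> bool" where
  "log_concave_fun f \<longleftrightarrow> continuous_on UNIV f \<and> (\<forall>x. 0 \<le> f x \<and> f x \<le> 1) \<and>
    (\<forall>x y t. 0 < t \<longrightarrow> t < 1 \<longrightarrow> f x powr t * f y powr (1 - t) \<le> f (\<lambda>i. t * x i + (1 - t) * y i))"

lemma continuous_on_vector_diff:
  "continuous_on UNIV (\<lambda>z i. x i - z i :: real)" "continuous_on UNIV (\<lambda>x i. x i - z i :: real)"
  by (intro continuous_on_coordinatewise_then_product continuous_intros continuous_on_product_coordinates)+

text \<open>For fixed \<open>x\<close> and \<open>y\<close>, the Prekopa-Leindler inequality for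
  \<open>\<mu>\<close> is applied to the functions of \<open>z\<close> obtained by evaluating
  \<open>f\<close> at \<open>x - z\<close>, at \<open>y - z\<close> and at their combination.
  Continuity is dominated convergence.\<close>

lemma log_concave_fun_smear:
  assumes lc: "log_concave n \<mu>" and f: "log_concave_fun f"
  shows "log_concave_fun (smear \<mu> f)"
proof -
  note lcD = log_concaveD[OF lc]
  interpret prob_space \<mu> by (rule lcD(1))
  note [measurable_cong] = lcD(2)
  have cont: "continuous_on UNIV f" and f0: "\<And>x. 0 \<le> f x" and f1: "\<And>x. f x \<le> 1"
    and fc: "\<And>x y t. 0 < t \<Longrightarrow> t < 1 \<Longrightarrow> f x powr t * f y powr (1 - t) \<le> f (\<lambda>i. t * x i + (1 - t) * y i)"
    using f by (auto simp: log_concave_fun_def)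
  have shift_meas: "(\<lambda>z. f (\<lambda>i. x i - z i)) \<in> borel_measurable borel" for x
    by (intro borel_measurable_continuous_onI continuous_on_compose2[OF cont continuous_on_vector_diff(1)]) auto
  then have shift_meas' [measurable]: "(\<lambda>z. f (\<lambda>i. x i - z i)) \<in> borel_measurable \<mu>" for x
    by (simp add: measurable_cong_sets[OF lcD(2) refl])
  have int: "integrable \<mu> (\<lambda>z. f (\<lambda>i. x i - z i))" for x
    by (rule integrable_const_bound[where B=1]) (auto simp: f0 f1)
  have "continuous_on UNIV (smear \<mu> f)"
    unfolding continuous_on_sequentially comp_def
  proof (intro allI ballI impI, elim conjE)
    fix X :: "nat \<Rightarrow> nat \<Rightarrow> real" and x assume X: "X \<longlonglongrightarrow> x"
    show "(\<lambda>k. smear \<mu> f (X k)) \<longlonglongrightarrow> smear \<mu> f x"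
      unfolding smear_def
    proof (rule integral_dominated_convergence[where w="\<lambda>_. 1"])
      show "AE z in \<mu>. (\<lambda>k. f (\<lambda>i. X k i - z i)) \<longlonglongrightarrow> f (\<lambda>i. x i - z i)"
      proof (rule AE_I2)
        fix z
        have "continuous_on UNIV (\<lambda>x. f (\<lambda>i. x i - z i))"
          by (intro continuous_on_compose2[OF cont continuous_on_vector_diff(2)]) auto
        then show "(\<lambda>k. f (\<lambda>i. X k i - z i)) \<longlonglongrightarrow> f (\<lambda>i. x i - z i)"
          using X unfolding continuous_on_sequentially comp_def by simp
      qed
    qed (auto simp: f0 f1)
  qed
  moreover have "0 \<le> smear \<mu> f x" for x
    unfolding smear_def by (simp add: integral_nonneg_AE f0)
  moreover have "smear \<mu> f x \<le> 1" for x
    unfolding smear_def by (rule integral_le_const) (auto simp: int f1)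
  moreover have "smear \<mu> f x powr t * smear \<mu> f y powr (1 - t) \<le> smear \<mu> f (\<lambda>i. t * x i + (1 - t) * y i)"
    if t: "0 < t" "t < 1" for x y t
    unfolding smear_def
  proof (rule log_concave_prekopa_leindler[OF lc t])
    fix v w
    have "(\<lambda>i. t * (x i - v i) + (1 - t) * (y i - w i)) = (\<lambda>i. t * x i + (1 - t) * y i - (t * v i + (1 - t) * w i))"
      by (simp add: algebra_simps)
    then show "f (\<lambda>i. x i - v i) powr t * f (\<lambda>i. y i - w i) powr (1 - t) \<le> f (\<lambda>i. t * x i + (1 - t) * y i - (t * v i + (1 - t) * w i))"
      using fc[OF t, of "\<lambda>i. x i - v i" "\<lambda>i. y i - w i"] by simp
  qed (auto simp: f0 f1 shift_meas)
  ultimately show ?thesis by (simp add: log_concave_fun_def)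
qed

text \<open>Tonelli and translation invariance move the convolution onto the test function
  \<open>w\<close>. Estimates of iterated convolutions against a Gaussian or a half-space thereby
  become inductions.\<close>

lemma nn_integral_smear:
  assumes lc: "log_concave n \<mu>" and f: "log_concave_fun f" and w [measurable]: "w \<in> borel_measurable borel"
  shows "(\<integral>\<^sup>+y. ennreal (smear \<mu> f y) * w y \<partial>lebn n) =
    (\<integral>\<^sup>+y. ennreal (f y) * (\<integral>\<^sup>+z. w (\<lambda>i. z i + y i) \<partial>\<mu>) \<partial>lebn n)"
proof -
  note lcD = log_concaveD[OF lc]
  interpret prob_space \<mu> by (rule lcD(1))
  note [measurable_cong] = lcD(2)
  interpret P: pair_sigma_finite \<mu> "lebn n"
    by (simp add: pair_sigma_finite_def sigma_finite_lebn sigma_finite_measure_axioms)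
  have cont: "continuous_on UNIV f" and f0: "\<And>x. 0 \<le> f x" and f1: "\<And>x. f x \<le> 1"
    using f by (auto simp: log_concave_fun_def)
  have [measurable]: "f \<in> borel_measurable borel" by (rule borel_measurable_continuous_onI[OF cont])
  have coord: "(\<lambda>p :: (nat \<Rightarrow> real) \<times> (nat \<Rightarrow> real). fst p i) \<in> borel_measurable (borel \<Otimes>\<^sub>M borel)"
      "(\<lambda>p :: (nat \<Rightarrow> real) \<times> (nat \<Rightarrow> real). snd p i) \<in> borel_measurable (borel \<Otimes>\<^sub>M borel)" for i
    by (rule measurable_compose[OF measurable_fst measurable_product_coordinates],
        rule measurable_compose[OF measurable_snd measurable_product_coordinates])
  have "(\<lambda>p i. snd p i - fst p i) \<in> measurable (borel \<Otimes>\<^sub>M borel) (borel :: (nat \<Rightarrow> real) measure)"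
    by (rule measurable_coordinatewise_then_product, rule borel_measurable_diff[OF coord(2) coord(1)])
  then have [measurable]: "(\<lambda>(z, y) i. y i - z i) \<in> measurable (borel \<Otimes>\<^sub>M borel) (borel :: (nat \<Rightarrow> real) measure)"
    unfolding case_prod_unfold .
  have "(\<lambda>p i. fst p i + snd p i) \<in> measurable (borel \<Otimes>\<^sub>M borel) (borel :: (nat \<Rightarrow> real) measure)"
    by (rule measurable_coordinatewise_then_product, rule borel_measurable_add[OF coord(1) coord(2)])
  then have [measurable]: "(\<lambda>(z, y) i. z i + y i) \<in> measurable (borel \<Otimes>\<^sub>M borel) (borel :: (nat \<Rightarrow> real) measure)"
    unfolding case_prod_unfold .
  have smear: "ennreal (smear \<mu> f y) = (\<integral>\<^sup>+z. ennreal (f (\<lambda>i. y i - z i)) \<partial>\<mu>)" for y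
    unfolding smear_def
    by (intro nn_integral_eq_integral[symmetric] integrable_const_bound[where B=1]) (auto simp: f0 f1)
  have "(\<integral>\<^sup>+y. ennreal (smear \<mu> f y) * w y \<partial>lebn n) = (\<integral>\<^sup>+y. \<integral>\<^sup>+z. ennreal (f (\<lambda>i. y i - z i)) * w y \<partial>\<mu> \<partial>lebn n)"
    unfolding smear by (intro nn_integral_cong nn_integral_multc[symmetric]) measurable
  also have "\<dots> = (\<integral>\<^sup>+z. \<integral>\<^sup>+y. ennreal (f (\<lambda>i. y i - z i)) * w y \<partial>lebn n \<partial>\<mu>)"
    by (rule P.Fubini') measurable
  also have "\<dots> = (\<integral>\<^sup>+z. \<integral>\<^sup>+y. ennreal (f y) * w (\<lambda>i. z i + y i) \<partial>lebn n \<partial>\<mu>)"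
  \<comment> \<open>Translation invariance of \<open>lebn n\<close> is used for
    \<open>z \<in> Rn n\<close>, which holds almost everywhere for \<open>\<mu>\<close>.\<close>
  proof (rule nn_integral_cong_AE, rule AE_mp[OF lcD(4)], rule AE_I2, rule impI)
    fix z assume "z \<in> Rn n"
    then have "(\<integral>\<^sup>+y. ennreal (f (\<lambda>i. y i - z i)) * w y \<partial>lebn n) =
      ennreal (\<bar>1\<bar> ^ n) * (\<integral>\<^sup>+y. ennreal (f (\<lambda>i. (z i + 1 * y i) - z i)) * w (\<lambda>i. z i + 1 * y i) \<partial>lebn n)"
      by (intro nn_integral_lebn_affine) auto
    then show "(\<integral>\<^sup>+y. ennreal (f (\<lambda>i. y i - z i)) * w y \<partial>lebn n) = (\<integral>\<^sup>+y. ennreal (f y) * w (\<lambda>i. z i + y i) \<partial>lebn n)"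
      by simp
  qed
  also have "\<dots> = (\<integral>\<^sup>+y. \<integral>\<^sup>+z. ennreal (f y) * w (\<lambda>i. z i + y i) \<partial>\<mu> \<partial>lebn n)"
    by (rule P.Fubini'[symmetric]) measurable
  also have "\<dots> = (\<integral>\<^sup>+y. ennreal (f y) * (\<integral>\<^sup>+z. w (\<lambda>i. z i + y i) \<partial>\<mu>) \<partial>lebn n)"
    by (intro nn_integral_cong nn_integral_cmult) measurable
  finally show ?thesis .
qed

text \<open>\<open>L\<close> is a unit lower triangular change of coordinates, hence volume
  preserving, and \<open>d j\<close> is the variance of its \<open>j\<close>-th coordinate. In the
  application \<open>L\<close> diagonalises the covariance form, so the product of the
  \<open>d j\<close> is the determinant of the covariance.\<close>

locale whitened_log_concave =
  fixes n :: nat and \<mu> :: "(nat \<Rightarrow> real) measure" and L :: "nat \<Rightarrow> nat \<Rightarrow> real" and d :: "nat \<Rightarrow> real"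
  assumes n_pos: "1 \<le> n" and lc: "log_concave n \<mu>" and cen: "centered n \<mu>"
    and d_pos: "0 < d j" and L_diag: "L j j = 1" and L_lower: "j < i \<Longrightarrow> L j i = 0"
    and variance: "j < n \<Longrightarrow> (\<integral>x. (\<Sum>i<n. L j i * x i)\<^sup>2 \<partial>\<mu>) = d j"
begin

section \<open>The covariance quadratic form and its Gaussian\<close>

definition y :: "nat \<Rightarrow> (nat \<Rightarrow> real) \<Rightarrow> real" where "y j x = (\<Sum>i<n. L j i * x i)"

text \<open>When \<open>L\<close> diagonalises the covariance, this is the quadratic form of the
  inverse covariance matrix.\<close>

definition q :: "(nat \<Rightarrow> real) \<Rightarrow> real" where "q x = (\<Sum>j<n. (y j x)\<^sup>2 / d j)"

lemmas lcD = log_concaveD[OF lc]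

sublocale prob_space \<mu> by (rule lcD(1))

lemma sets_\<mu> [measurable_cong]: "sets \<mu> = sets borel" by (rule lcD(2))

lemma y_measurable [measurable]: "y j \<in> borel_measurable borel"
  unfolding y_def by measurable

lemma q_measurable [measurable]: "q \<in> borel_measurable borel"
  unfolding q_def by measurable

lemma y_comb: "y j (\<lambda>i. s * u i + t * v i) = s * y j u + t * y j v"
  by (simp add: y_def sum.distrib sum_distrib_left algebra_simps)

lemma q_nonneg: "0 \<le> q x"
  unfolding q_def by (intro sum_nonneg divide_nonneg_pos) (auto simp: d_pos)

lemma y_add: "y j (\<lambda>i. u i + v i) = y j u + y j v"
  using y_comb[of j 1 u 1 v] by simp

lemma y_moments:
  assumes "j < n"
  shows "integrable \<mu> (y j)" "(\<integral>x. y j x \<partial>\<mu>) = 0" "integrable \<mu> (\<lambda>x. (y j x)\<^sup>2)" "(\<integral>x. (y j x)\<^sup>2 \<partial>\<mu>) = d j"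
proof -
  have int: "integrable \<mu> (\<lambda>x. x i)" "(\<integral>x. x i \<partial>\<mu>) = 0" if "i < n" for i
    using cen that by (auto simp: centered_def)
  then show "integrable \<mu> (y j)" "(\<integral>x. y j x \<partial>\<mu>) = 0"
    unfolding y_def[abs_def]
    by (auto intro!: Bochner_Integration.integrable_sum simp: Bochner_Integration.integral_sum)
  have "(y j x)\<^sup>2 = (\<Sum>i<n. \<Sum>k<n. L j i * L j k * (x i * x k))" for x
    by (simp add: y_def power2_eq_square sum_product mult_ac)
  then show "integrable \<mu> (\<lambda>x. (y j x)\<^sup>2)"
    by (auto intro!: Bochner_Integration.integrable_sum log_concave_product_integrable[OF lc])
  show "(\<integral>x. (y j x)\<^sup>2 \<partial>\<mu>) = d j" unfolding y_def by (rule variance) fact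
qed

text \<open>Centering removes the cross terms, and each squared coordinate divided by its variance
  contributes 1, hence the summand \<open>n\<close>.\<close>

lemma q_shift:
  shows "integrable \<mu> (\<lambda>z. q (\<lambda>i. z i + x i))" "(\<integral>z. q (\<lambda>i. z i + x i) \<partial>\<mu>) = q x + real n"
proof -
  have eq: "(y j (\<lambda>i. z i + x i))\<^sup>2 / d j = (y j z)\<^sup>2 / d j + (2 * y j x / d j) * y j z + (y j x)\<^sup>2 / d j" for j z
    by (simp add: y_add power2_eq_square field_simps add_divide_distrib)
  have I: "integrable \<mu> (\<lambda>z. (y j (\<lambda>i. z i + x i))\<^sup>2 / d j)"
    "(\<integral>z. (y j (\<lambda>i. z i + x i))\<^sup>2 / d j \<partial>\<mu>) = 1 + (y j x)\<^sup>2 / d j" if "j < n" for j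
    unfolding eq using y_moments[OF that] d_pos[of j] by (simp_all add: prob_space)
  show "integrable \<mu> (\<lambda>z. q (\<lambda>i. z i + x i))"
    unfolding q_def by (intro Bochner_Integration.integrable_sum I) auto
  have "(\<integral>z. q (\<lambda>i. z i + x i) \<partial>\<mu>) = (\<Sum>j<n. \<integral>z. (y j (\<lambda>i. z i + x i))\<^sup>2 / d j \<partial>\<mu>)"
    unfolding q_def by (intro Bochner_Integration.integral_sum I) auto
  also have "\<dots> = (\<Sum>j<n. 1 + (y j x)\<^sup>2 / d j)" by (intro sum.cong I(2)) auto
  finally show "(\<integral>z. q (\<lambda>i. z i + x i) \<partial>\<mu>) = q x + real n" by (simp add: sum.distrib q_def)
qed

lemma q_convex:
  assumes t: "0 < t" "t < 1"
  shows "q (\<lambda>i. t * u i + (1 - t) * v i) \<le> t * q u + (1 - t) * q v"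
proof -
  have sq: "(t * a + (1 - t) * b)\<^sup>2 \<le> t * a\<^sup>2 + (1 - t) * b\<^sup>2" for a b :: real
  proof -
    have "0 \<le> t * (1 - t) * (a - b)\<^sup>2" using t by simp
    then show ?thesis by (simp add: power2_eq_square algebra_simps)
  qed
  have "q (\<lambda>i. t * u i + (1 - t) * v i) \<le> (\<Sum>j<n. (t * (y j u)\<^sup>2 + (1 - t) * (y j v)\<^sup>2) / d j)"
    unfolding q_def y_comb using d_pos by (intro sum_mono divide_right_mono sq) (simp add: less_imp_le)
  also have "\<dots> = t * q u + (1 - t) * q v"
    by (simp add: q_def add_divide_distrib sum.distrib sum_distrib_left)
  finally show ?thesis .
qed

lemma log_concave_fun_gauss:
  assumes "0 < c"
  shows "log_concave_fun (\<lambda>x. exp (- (q x / c)))"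
  unfolding log_concave_fun_def
proof (intro conjI allI impI)
  show "continuous_on UNIV (\<lambda>x. exp (- (q x / c)))"
    unfolding q_def y_def using assms d_pos
    by (intro continuous_intros continuous_on_product_coordinates) (auto simp: less_imp_neq[symmetric])
  fix u v :: "nat \<Rightarrow> real" and t :: real assume t: "0 < t" "t < 1"
  have "exp (- (q u / c)) powr t * exp (- (q v / c)) powr (1 - t) = exp (- ((t * q u + (1 - t) * q v) / c))"
    by (simp add: powr_def exp_add[symmetric] add_divide_distrib diff_divide_distrib algebra_simps)
  also have "\<dots> \<le> exp (- (q (\<lambda>i. t * u i + (1 - t) * v i) / c))"
    using q_convex[OF t, of u v] assms by (subst exp_le_cancel_iff, subst neg_le_iff_le, intro divide_right_mono) auto
  finally show "exp (- (q u / c)) powr t * exp (- (q v / c)) powr (1 - t) \<le> exp (- (q (\<lambda>i. t * u i + (1 - t) * v i) / c))" .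
qed (use assms q_nonneg in auto)

text \<open>The total mass of the Gaussian \<open>exp (- q x / c)\<close>.\<close>

definition vol :: "real \<Rightarrow> real" where "vol c = sqrt (pi * c) ^ n * sqrt (\<Prod>j<n. d j)"

lemma vol_pos: "0 < c \<Longrightarrow> 0 < vol c"
  by (simp add: vol_def d_pos prod_pos)

text \<open>Each \<open>y j x\<close> is \<open>x j\<close> plus a function of earlier coordinates,
  so the triangular Gaussian integral applies with \<open>c * d j\<close> in place of
  \<open>d j\<close>.\<close>

lemma nn_integral_gauss:
  assumes c: "0 < c"
  shows "(\<integral>\<^sup>+x. ennreal (exp (- (q x / c))) \<partial>lebn n) = ennreal (vol c)"
proof -
  define l where "l j x = (\<Sum>i<j. L j i * x i)" for j and x :: "nat \<Rightarrow> real"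
  have y_eq: "y j x = x j + l j x" if "j < n" for j x
  proof -
    have "y j x = (\<Sum>i\<in>{..<Suc j}. L j i * x i)"
      unfolding y_def using that by (intro sum.mono_neutral_right) (auto simp: L_lower)
    then show ?thesis by (simp add: l_def L_diag)
  qed
  have "(\<integral>\<^sup>+x. ennreal (exp (- (\<Sum>j<n. (x j + l j x)\<^sup>2 / (c * d j)))) \<partial>lebn n) = ennreal (\<Prod>j<n. sqrt (pi * (c * d j)))"
    by (rule nn_integral_gaussian_lebn) (use c d_pos in \<open>auto simp: l_def\<close>)
  also have "(\<Prod>j<k. sqrt (pi * (c * d j))) = sqrt (pi * c) ^ k * sqrt (\<Prod>j<k. d j)" for k
    by (induction k) (auto simp: real_sqrt_mult)
  then have "(\<Prod>j<n. sqrt (pi * (c * d j))) = vol c" unfolding vol_def .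
  also have "(\<lambda>x. exp (- (\<Sum>j<n. (x j + l j x)\<^sup>2 / (c * d j)))) = (\<lambda>x. exp (- (q x / c)))"
    by (simp add: q_def y_eq sum_divide_distrib mult.commute fun_eq_iff sum_negf)
  finally show ?thesis .
qed

text \<open>Jensen's inequality, in the form of the tangent line of the exponential at the mean of \<open>q\<close>.\<close>

lemma exp_mean_le:
  assumes c: "0 < c"
  shows "ennreal (exp (- ((q x + real n) / c))) \<le> (\<integral>\<^sup>+z. ennreal (exp (- (q (\<lambda>i. z i + x i) / c))) \<partial>\<mu>)"
proof -
  define a where "a = (q x + real n) / c"
  have [measurable]: "(\<lambda>z i. z i + x i) \<in> borel \<rightarrow>\<^sub>M (borel :: (nat \<Rightarrow> real) measure)"
    by (rule measurable_coordinatewise_then_product) simp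
  have int: "integrable \<mu> (\<lambda>z. exp (- (q (\<lambda>i. z i + x i) / c)))"
    using c by (intro integrable_const_bound[where B=1]) (auto simp: q_nonneg)
  have "exp (- a) = (\<integral>z. exp (- a) * (1 - (q (\<lambda>i. z i + x i) / c - a)) \<partial>\<mu>)"
    using q_shift[of x] c by (simp add: prob_space a_def diff_divide_distrib add_divide_distrib)
  also have "\<dots> \<le> (\<integral>z. exp (- (q (\<lambda>i. z i + x i) / c)) \<partial>\<mu>)"
  proof (rule integral_mono[OF _ int])
    show "integrable \<mu> (\<lambda>z. exp (- a) * (1 - (q (\<lambda>i. z i + x i) / c - a)))"
      using q_shift[of x] by simp
    fix z
    have "exp (- a) * (1 + (a - (q (\<lambda>i. z i + x i) / c))) \<le> exp (- a) * exp (a - (q (\<lambda>i. z i + x i) / c))"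
      by (intro mult_left_mono exp_ge_add_one_self) auto
    then show "exp (- a) * (1 - (q (\<lambda>i. z i + x i) / c - a)) \<le> exp (- (q (\<lambda>i. z i + x i) / c))"
      by (simp add: exp_add[symmetric] algebra_simps)
  qed
  finally have "ennreal (exp (- a)) \<le> ennreal (\<integral>z. exp (- (q (\<lambda>i. z i + x i) / c)) \<partial>\<mu>)" by (rule ennreal_leI)
  also have "\<dots> = (\<integral>\<^sup>+z. ennreal (exp (- (q (\<lambda>i. z i + x i) / c))) \<partial>\<mu>)"
    using int by (intro nn_integral_eq_integral[symmetric]) auto
  finally show ?thesis unfolding a_def .
qed

text \<open>Up to the factor \<open>vol c\<close>, the density of a Gaussian point plus
  \<open>k\<close> independent points of law \<open>\<mu>\<close>. Leaving it unnormalised keeps its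
  values in [0,1].\<close>

definition iter :: "real \<Rightarrow> nat \<Rightarrow> (nat \<Rightarrow> real) \<Rightarrow> real" where
  "iter c k = (smear \<mu> ^^ k) (\<lambda>x. exp (- (q x / c)))"

lemma iter_0: "iter c 0 = (\<lambda>x. exp (- (q x / c)))" and iter_Suc: "iter c (Suc k) = smear \<mu> (iter c k)"
  by (simp_all add: iter_def)

lemma iter_log_concave: "0 < c \<Longrightarrow> log_concave_fun (iter c k)"
  by (induction k) (auto simp: iter_0 iter_Suc log_concave_fun_gauss log_concave_fun_smear[OF lc])

lemma iterD:
  assumes "0 < c"
  shows "continuous_on UNIV (iter c k)" "0 \<le> iter c k x" "iter c k x \<le> 1" "iter c k \<in> borel_measurable borel"
    "0 < t \<Longrightarrow> t < 1 \<Longrightarrow> iter c k u powr t * iter c k v powr (1 - t) \<le> iter c k (\<lambda>i. t * u i + (1 - t) * v i)"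
  using iter_log_concave[OF assms, of k] by (auto simp: log_concave_fun_def intro: borel_measurable_continuous_onI)

lemma nn_integral_iter_Suc:
  assumes "0 < c" "w \<in> borel_measurable borel"
  shows "(\<integral>\<^sup>+x. ennreal (iter c (Suc k) x) * w x \<partial>lebn n) =
    (\<integral>\<^sup>+x. ennreal (iter c k x) * (\<integral>\<^sup>+z. w (\<lambda>i. z i + x i) \<partial>\<mu>) \<partial>lebn n)"
  unfolding iter_Suc by (rule nn_integral_smear[OF lc iter_log_concave[OF assms(1)] assms(2)])

section \<open>Mass, peak and half-space content of the iterated convolutions\<close>

lemma iter_mass:
  assumes c: "0 < c"
  shows "(\<integral>\<^sup>+x. ennreal (iter c k x) \<partial>lebn n) = ennreal (vol c)"
proof (induction k)
  case 0
  show ?case by (simp add: iter_0 nn_integral_gauss c)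
next
  case (Suc k)
  then show ?case using nn_integral_iter_Suc[OF c, of "\<lambda>_. 1" k] by (simp add: emeasure_space_1)
qed

text \<open>Each convolution is moved onto the Gaussian weight, where averaging over
  \<open>\<mu>\<close> costs at most a factor \<open>exp (- n / c)\<close> by
  \<open>exp_mean_le\<close>. For \<open>c = k = m\<close> the total loss is e^(-n), whatever
  \<open>m\<close> is.\<close>

lemma iter_gauss_mass:
  assumes c: "0 < c"
  shows "ennreal (exp (- (real n / c)) ^ k * vol (c / 2)) \<le>
    (\<integral>\<^sup>+x. ennreal (iter c k x) * ennreal (exp (- (q x / c))) \<partial>lebn n)"
proof (induction k)
  case 0
  have "ennreal (iter c 0 x) * ennreal (exp (- (q x / c))) = ennreal (exp (- (q x / (c / 2))))" for x
    by (simp add: iter_0 ennreal_mult[symmetric] exp_add[symmetric])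
  then show ?case using nn_integral_gauss[of "c / 2"] c by simp
next
  case (Suc k)
  note [measurable] = iterD(4)[OF c, of k]
  have split: "exp (- ((q x + real n) / c)) = exp (- (real n / c)) * exp (- (q x / c))" for x
    by (simp add: exp_add[symmetric] add_divide_distrib diff_divide_distrib)
  have "ennreal (exp (- (real n / c)) ^ Suc k * vol (c / 2)) = ennreal (exp (- (real n / c))) * ennreal (exp (- (real n / c)) ^ k * vol (c / 2))"
    by (simp add: ennreal_mult'[symmetric] mult.assoc)
  also have "\<dots> \<le> ennreal (exp (- (real n / c))) * (\<integral>\<^sup>+x. ennreal (iter c k x) * ennreal (exp (- (q x / c))) \<partial>lebn n)"
    by (intro mult_left_mono Suc) auto
  also have "\<dots> = (\<integral>\<^sup>+x. ennreal (iter c k x) * ennreal (exp (- ((q x + real n) / c))) \<partial>lebn n)"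
    by (subst nn_integral_cmult[symmetric]) (auto simp: split ennreal_mult mult_ac)
  also have "\<dots> \<le> (\<integral>\<^sup>+x. ennreal (iter c k x) * (\<integral>\<^sup>+z. ennreal (exp (- (q (\<lambda>i. z i + x i) / c))) \<partial>\<mu>) \<partial>lebn n)"
    by (intro nn_integral_mono mult_left_mono exp_mean_le c) auto
  also have "\<dots> = (\<integral>\<^sup>+x. ennreal (iter c (Suc k) x) * ennreal (exp (- (q x / c))) \<partial>lebn n)"
    by (rule nn_integral_iter_Suc[symmetric, OF c]) measurable
  finally show ?case .
qed

text \<open>If the function stayed below e^(-2n), its integral against the Gaussian would be at most
  e^(-2n) \<open>vol m\<close>. It is at least e^(-n) \<open>vol (m / 2)\<close>, which equals
  e^(-n) 2^(-n/2) \<open>vol m\<close>, and 1/e is smaller than the square root of 1/2.\<close>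

lemma iter_peak:
  assumes m: "1 \<le> m"
  obtains x where "x \<in> Rn n" "exp (- (2 * real n)) \<le> iter (real m) m x"
proof (rule ccontr)
  assume "\<not> thesis"
  with that have small: "iter (real m) m x \<le> exp (- (2 * real n))" if "x \<in> Rn n" for x
    using \<open>x \<in> Rn n\<close> by force
  have c: "0 < real m" using m by simp
  have "exp (- (real n / real m)) ^ m = exp (- real n)"
    using m by (simp add: exp_of_nat_mult[symmetric])
  then have "ennreal (exp (- real n) * vol (real m / 2)) \<le> (\<integral>\<^sup>+x. ennreal (iter (real m) m x) * ennreal (exp (- (q x / real m))) \<partial>lebn n)"
    using iter_gauss_mass[OF c, of m] by simp
  also have "\<dots> \<le> (\<integral>\<^sup>+x. ennreal (exp (- (2 * real n))) * ennreal (exp (- (q x / real m))) \<partial>lebn n)"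
    by (rule nn_integral_mono_AE, rule AE_mp[OF AE_lebn_Rn])
      (auto intro!: AE_I2 mult_right_mono ennreal_leI small)
  also have "\<dots> = ennreal (exp (- (2 * real n)) * vol (real m))"
    using c by (subst nn_integral_cmult) (auto simp: nn_integral_gauss ennreal_mult')
  finally have le: "exp (- real n) * vol (real m / 2) \<le> exp (- (2 * real n)) * vol (real m)"
    using vol_pos[OF c] by (simp add: ennreal_le_iff)
  have "vol (real m / 2) = sqrt (1 / 2) ^ n * vol (real m)"
    by (simp add: vol_def real_sqrt_mult real_sqrt_divide power_mult_distrib power_divide)
  moreover have "exp (- (2 * real n)) = exp (- real n) * exp (- 1) ^ n"
    by (simp add: exp_of_nat_mult[symmetric] exp_add[symmetric])
  ultimately have "sqrt (1 / 2) ^ n \<le> exp (- 1 :: real) ^ n" using le vol_pos[OF c] by simp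
  moreover have "exp (- 1 :: real) < sqrt (1 / 2)"
  proof -
    have "exp (- 1 :: real) \<le> 1 / 2"
      using exp_ge_add_one_self[of 1] by (simp add: exp_minus field_simps)
    also have "1 / 2 < sqrt (1 / 2 :: real)" by (rule real_less_rsqrt) (simp add: power2_eq_square)
    finally show ?thesis .
  qed
  then have "exp (- 1 :: real) ^ n < sqrt (1 / 2) ^ n" using n_pos by (intro power_strict_mono) auto
  ultimately show False by simp
qed

text \<open>At the midpoint of \<open>x\<close> and a peak \<open>x0\<close>, log-concavity gives
  \<open>sqrt (f x) * exp (- n) \<le> f ((x + x0) / 2)\<close>; the substitution by midpoints costs
  2^n. This later turns pointwise smallness on a half-space into small mass.\<close>

lemma iter_sqrt_mass:
  assumes m: "1 \<le> m"
  shows "(\<integral>\<^sup>+x. ennreal (sqrt (iter (real m) m x)) \<partial>lebn n) \<le> ennreal (2 ^ n * exp (real n) * vol (real m))"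
proof -
  have c: "0 < real m" using m by simp
  define f where "f = iter (real m) m"
  have [measurable]: "f \<in> borel_measurable borel" and f0: "\<And>x. 0 \<le> f x" using iterD[OF c] by (auto simp: f_def)
  obtain x0 where x0: "x0 \<in> Rn n" "exp (- (2 * real n)) \<le> f x0" using iter_peak[OF m] unfolding f_def by blast
  define z where "z i = x0 i / 2" for i
  have z: "z \<in> Rn n" using x0 by (auto simp: z_def Rn_def)
  have "sqrt (f x) \<le> exp (real n) * f (\<lambda>i. z i + 1 / 2 * x i)" for x
  proof -
    have "exp (- real n) = sqrt (exp (- (2 * real n)))"
      by (rule real_sqrt_unique[symmetric]) (auto simp: power2_eq_square exp_add[symmetric])
    also have "\<dots> \<le> sqrt (f x0)" using x0 by simp
    finally have "sqrt (f x) * exp (- real n) \<le> sqrt (f x) * sqrt (f x0)" by (intro mult_left_mono) (auto simp: f0)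
    also have "\<dots> = f x powr (1 / 2) * f x0 powr (1 - 1 / 2)" using f0 by (simp add: powr_half_sqrt)
    also have "\<dots> \<le> f (\<lambda>i. 1 / 2 * x i + (1 - 1 / 2) * x0 i)" unfolding f_def by (rule iterD(5)[OF c]) auto
    also have "(\<lambda>i. 1 / 2 * x i + (1 - 1 / 2) * x0 i) = (\<lambda>i. z i + 1 / 2 * x i)" by (auto simp: z_def)
    finally have "exp (real n) * (sqrt (f x) * exp (- real n)) \<le> exp (real n) * f (\<lambda>i. z i + 1 / 2 * x i)"
      by (rule mult_left_mono) simp
    moreover have "exp (real n) * (sqrt (f x) * exp (- real n)) = sqrt (f x)" by (simp add: exp_minus)
    ultimately show ?thesis by (simp only:)
  qed
  then have "(\<integral>\<^sup>+x. ennreal (sqrt (f x)) \<partial>lebn n) \<le> (\<integral>\<^sup>+x. ennreal (exp (real n)) * ennreal (f (\<lambda>i. z i + 1 / 2 * x i)) \<partial>lebn n)"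
    by (intro nn_integral_mono) (auto simp: ennreal_mult'[symmetric] intro!: ennreal_leI)
  also have "\<dots> = ennreal (exp (real n)) * (\<integral>\<^sup>+x. ennreal (f (\<lambda>i. z i + 1 / 2 * x i)) \<partial>lebn n)"
    using measurable_compose[OF measurable_affine[of z "1 / 2"], of "\<lambda>x. ennreal (f x)"]
    by (intro nn_integral_cmult) simp
  also have "(\<integral>\<^sup>+x. ennreal (f (\<lambda>i. z i + 1 / 2 * x i)) \<partial>lebn n) = ennreal (2 ^ n) * (ennreal (\<bar>1 / 2\<bar> ^ n) * (\<integral>\<^sup>+x. ennreal (f (\<lambda>i. z i + 1 / 2 * x i)) \<partial>lebn n))"
    by (simp add: mult.assoc[symmetric] ennreal_mult'[symmetric] power_mult_distrib[symmetric])
  also have "ennreal (\<bar>1 / 2\<bar> ^ n) * (\<integral>\<^sup>+x. ennreal (f (\<lambda>i. z i + 1 / 2 * x i)) \<partial>lebn n) = (\<integral>\<^sup>+x. ennreal (f x) \<partial>lebn n)"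
    using z by (intro nn_integral_lebn_affine[symmetric]) auto
  also have "\<dots> = ennreal (vol (real m))" unfolding f_def by (rule iter_mass[OF c])
  also have "ennreal (exp (real n)) * (ennreal (2 ^ n) * ennreal (vol (real m))) = ennreal (2 ^ n * exp (real n) * vol (real m))"
    using vol_pos[OF c] by (simp add: ennreal_mult mult_ac)
  finally show ?thesis by (simp add: f_def)
qed

text \<open>By symmetry the starting Gaussian gives at least half of its mass to a half-space
  bounded by a hyperplane through 0. If \<open>x\<close> has level at least \<open>k * b\<close> and
  \<open>z\<close> level above \<open>b\<close>, the sum has level at least
  \<open>(k + 1) * b\<close>, so each convolution multiplies the bound by the measure of the
  half-space.\<close>

lemma iter_halfspace:
  assumes c: "0 < c"
  shows "ennreal (measure \<mu> {x. b < (\<Sum>i<n. \<theta> i * x i)} ^ k * (vol c / 2)) \<le>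
    (\<integral>\<^sup>+x. ennreal (iter c k x) * indicator {x. real k * b \<le> (\<Sum>i<n. \<theta> i * x i)} x \<partial>lebn n)"
proof (induction k)
  case 0
  let ?H = "{x. 0 \<le> (\<Sum>i<n. \<theta> i * x i)} :: (nat \<Rightarrow> real) set"
  let ?g = "\<lambda>x. ennreal (exp (- (q x / c))) * indicator ?H x"
  have q_neg: "q (\<lambda>i. - x i) = q x" for x using y_comb[of _ "-1" x 0 x] by (simp add: q_def)
  have "(\<integral>\<^sup>+x. ?g x \<partial>lebn n) = ennreal (\<bar>- 1\<bar> ^ n) * (\<integral>\<^sup>+x. ?g (\<lambda>i. 0 + - 1 * x i) \<partial>lebn n)"
    by (rule nn_integral_lebn_affine) (auto simp: Rn_def)
  also have "\<dots> = (\<integral>\<^sup>+x. ?g (\<lambda>i. - x i) \<partial>lebn n)" by simp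
  finally have refl: "(\<integral>\<^sup>+x. ?g x \<partial>lebn n) = (\<integral>\<^sup>+x. ?g (\<lambda>i. - x i) \<partial>lebn n)" .
  have neg [measurable]: "(\<lambda>x i. - x i) \<in> borel \<rightarrow>\<^sub>M (borel :: (nat \<Rightarrow> real) measure)"
    by (rule measurable_coordinatewise_then_product) simp
  have "ennreal (vol c) = (\<integral>\<^sup>+x. ennreal (exp (- (q x / c))) \<partial>lebn n)" using nn_integral_gauss[OF c] by simp
  also have "\<dots> \<le> (\<integral>\<^sup>+x. ?g x + ?g (\<lambda>i. - x i) \<partial>lebn n)"
    by (intro nn_integral_mono) (auto simp: indicator_def q_neg sum_negf)
  also have "\<dots> = (\<integral>\<^sup>+x. ?g x \<partial>lebn n) + (\<integral>\<^sup>+x. ?g (\<lambda>i. - x i) \<partial>lebn n)"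
    by (rule nn_integral_add) measurable
  also have "\<dots> = 2 * (\<integral>\<^sup>+x. ?g x \<partial>lebn n)" unfolding refl[symmetric] by (simp add: mult_2)
  finally have "ennreal (1 / 2) * ennreal (vol c) \<le> ennreal (1 / 2) * (2 * (\<integral>\<^sup>+x. ?g x \<partial>lebn n))"
    by (intro mult_left_mono) auto
  also have "\<dots> = (\<integral>\<^sup>+x. ?g x \<partial>lebn n)"
  proof -
    have "ennreal (1 / 2) * 2 = 1" using ennreal_mult[of "1 / 2" 2] by simp
    then show ?thesis by (simp add: mult.assoc[symmetric])
  qed
  also have "ennreal (1 / 2) * ennreal (vol c) = ennreal (vol c / 2)"
    using vol_pos[OF c] by (subst ennreal_mult[symmetric]) auto
  finally show ?case by (simp add: iter_0)
next
  case (Suc k)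
  let ?U = "{x. b < (\<Sum>i<n. \<theta> i * x i)} :: (nat \<Rightarrow> real) set"
  let ?H = "\<lambda>k. {x. real k * b \<le> (\<Sum>i<n. \<theta> i * x i)} :: (nat \<Rightarrow> real) set"
  note [measurable] = iterD(4)[OF c, of k]
  have "ennreal (measure \<mu> ?U ^ Suc k * (vol c / 2)) = ennreal (measure \<mu> ?U) * ennreal (measure \<mu> ?U ^ k * (vol c / 2))"
    by (simp add: ennreal_mult'[symmetric] mult.assoc)
  also have "\<dots> \<le> ennreal (measure \<mu> ?U) * (\<integral>\<^sup>+x. ennreal (iter c k x) * indicator (?H k) x \<partial>lebn n)"
    by (intro mult_left_mono Suc) auto
  also have "\<dots> = (\<integral>\<^sup>+x. ennreal (iter c k x) * (indicator (?H k) x * emeasure \<mu> ?U) \<partial>lebn n)"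
    by (subst nn_integral_cmult[symmetric]) (auto simp: emeasure_eq_measure mult_ac)
  also have "\<dots> \<le> (\<integral>\<^sup>+x. ennreal (iter c k x) * (\<integral>\<^sup>+z. indicator (?H (Suc k)) (\<lambda>i. z i + x i) \<partial>\<mu>) \<partial>lebn n)"
  proof (intro nn_integral_mono mult_left_mono)
    fix x
    have "indicator (?H k) x * emeasure \<mu> ?U = (\<integral>\<^sup>+z. indicator (?H k) x * indicator ?U z \<partial>\<mu>)"
      by (subst nn_integral_cmult) (auto simp: lcD(2))
    also have "\<dots> \<le> (\<integral>\<^sup>+z. indicator (?H (Suc k)) (\<lambda>i. z i + x i) \<partial>\<mu>)"
      by (intro nn_integral_mono) (auto simp: indicator_def algebra_simps sum.distrib)
    finally show "indicator (?H k) x * emeasure \<mu> ?U \<le> (\<integral>\<^sup>+z. indicator (?H (Suc k)) (\<lambda>i. z i + x i) \<partial>\<mu>)" .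
  qed auto
  also have "\<dots> = (\<integral>\<^sup>+x. ennreal (iter c (Suc k) x) * indicator (?H (Suc k)) x \<partial>lebn n)"
    by (rule nn_integral_iter_Suc[symmetric, OF c]) measurable
  finally show ?case .
qed

text \<open>\<open>G\<close> is a superlevel set of the iterate \<open>f\<close>, shrunk by
  \<open>m\<close> to pass from sums to averages. Markov's inequality bounds its volume and
  log-concavity makes it convex. If a half-space misses \<open>G\<close>, then \<open>f\<close> is
  below e^(-8n) on its dilate, hence at most e^(-4n) times its own square root there. Comparing
  \<open>iter_sqrt_mass\<close> with \<open>iter_halfspace\<close> bounds the \<open>m\<close>-th
  power of the half-space's measure by e^(-n).\<close>

lemma depth_region:
  assumes m: "1 \<le> (m::nat)"
  obtains G where "closed G" "emeasure (lebn n) G \<le> ennreal (exp (8 * real n) * vol (real m) / real m ^ n)"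
    "\<And>u v t. u \<in> G \<Longrightarrow> v \<in> G \<Longrightarrow> 0 < t \<Longrightarrow> t < 1 \<Longrightarrow> (\<lambda>i. t * u i + (1 - t) * v i) \<in> G"
    "\<And>\<theta> b. (\<And>x. x \<in> G \<Longrightarrow> x \<in> Rn n \<Longrightarrow> (\<Sum>i<n. \<theta> i * x i) < b) \<Longrightarrow>
      measure \<mu> {x. b < (\<Sum>i<n. \<theta> i * x i)} \<le> exp (- (real n / real m))"
proof -
  have c: "0 < real m" using m by simp
  define f where "f = iter (real m) m"
  note fD = iterD[OF c, where k=m, folded f_def]
  note [measurable] = fD(4)
  \<comment> \<open>The square root halves the exponent 8; the remaining e^(-4n) absorbs e^n from
    \<open>iter_sqrt_mass\<close> and \<open>2 * 2 ^ n\<close>, which is at most e^(2n), and leaves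
    e^(-n).\<close>
  define G where "G = {x. exp (- (8 * real n)) \<le> f (\<lambda>i. real m * x i)}"
  have scale: "continuous_on UNIV (\<lambda>x i. real m * x i)"
    by (intro continuous_on_coordinatewise_then_product continuous_intros continuous_on_product_coordinates)
  have G: "closed G"
    unfolding G_def by (intro closed_Collect_le continuous_intros continuous_on_compose2[OF fD(1) scale]) auto
  show thesis
  proof
    show "closed G" by (rule G)
    show "emeasure (lebn n) G \<le> ennreal (exp (8 * real n) * vol (real m) / real m ^ n)"
    proof -
      let ?A = "{x. exp (- (8 * real n)) \<le> f x}"
      have "emeasure (lebn n) {x \<in> UNIV. 1 \<le> ennreal (exp (8 * real n)) * ennreal (f x)} \<le>
          ennreal (exp (8 * real n)) * (\<integral>\<^sup>+x. ennreal (f x) * indicator UNIV x \<partial>lebn n)"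
        by (rule nn_integral_Markov_inequality) measurable
      also have "{x \<in> UNIV. 1 \<le> ennreal (exp (8 * real n)) * ennreal (f x)} = ?A"
      proof -
        have "1 \<le> ennreal (exp (8 * real n)) * ennreal (f x) \<longleftrightarrow> exp (- (8 * real n)) \<le> f x" for x
        proof -
          have "ennreal (exp (8 * real n)) * ennreal (f x) = ennreal (exp (8 * real n) * f x)"
            by (rule ennreal_mult'[symmetric]) simp
          then have "1 \<le> ennreal (exp (8 * real n)) * ennreal (f x) \<longleftrightarrow> 1 \<le> exp (8 * real n) * f x"
            by (simp only: ennreal_ge_1)
          then show ?thesis by (simp add: exp_minus field_simps)
        qed
        then show ?thesis by blast
      qed
      also have "(\<integral>\<^sup>+x. ennreal (f x) * indicator UNIV x \<partial>lebn n) = ennreal (vol (real m))"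
        unfolding f_def using iter_mass[OF c] by simp
      finally have A: "emeasure (lebn n) ?A \<le> ennreal (exp (8 * real n) * vol (real m))"
        by (simp add: ennreal_mult')
      have [measurable]: "G \<in> sets borel" using G by (rule borel_closed)
      have "(\<integral>\<^sup>+x. indicator ?A x \<partial>lebn n) = ennreal (\<bar>real m\<bar> ^ n) * (\<integral>\<^sup>+x. indicator ?A (\<lambda>i. 0 + real m * x i) \<partial>lebn n)"
        using c by (intro nn_integral_lebn_affine) (auto simp: Rn_def)
      also have "(\<lambda>x. indicator ?A (\<lambda>i. 0 + real m * x i)) = (indicator G :: _ \<Rightarrow> ennreal)"
        by (auto simp: G_def indicator_def fun_eq_iff)
      finally have "emeasure (lebn n) ?A = ennreal (real m ^ n) * emeasure (lebn n) G" by simp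
      then have "ennreal (1 / real m ^ n) * (ennreal (real m ^ n) * emeasure (lebn n) G) \<le>
          ennreal (1 / real m ^ n) * ennreal (exp (8 * real n) * vol (real m))"
        using A by (intro mult_left_mono) auto
      moreover have "ennreal (1 / real m ^ n) * (ennreal (real m ^ n) * emeasure (lebn n) G) = emeasure (lebn n) G"
        using c by (simp add: mult.assoc[symmetric] ennreal_mult'[symmetric])
      ultimately show ?thesis by (simp add: ennreal_mult'[symmetric])
    qed
  next
    fix u v :: "nat \<Rightarrow> real" and t :: real assume uv: "u \<in> G" "v \<in> G" and t: "0 < t" "t < 1"
    have "exp (- (8 * real n)) = exp (- (8 * real n)) powr t * exp (- (8 * real n)) powr (1 - t)"
      by (simp add: powr_add[symmetric])
    also have "\<dots> \<le> f (\<lambda>i. real m * u i) powr t * f (\<lambda>i. real m * v i) powr (1 - t)"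
      using uv t by (intro mult_mono powr_mono2) (auto simp: G_def)
    also have "\<dots> \<le> f (\<lambda>i. t * (real m * u i) + (1 - t) * (real m * v i))" by (rule fD(5)[OF t])
    also have "(\<lambda>i. t * (real m * u i) + (1 - t) * (real m * v i)) = (\<lambda>i. real m * (t * u i + (1 - t) * v i))"
      by (simp add: algebra_simps)
    finally show "(\<lambda>i. t * u i + (1 - t) * v i) \<in> G" by (simp add: G_def)
  next
    fix \<theta> :: "nat \<Rightarrow> real" and b assume out: "\<And>x. x \<in> G \<Longrightarrow> x \<in> Rn n \<Longrightarrow> (\<Sum>i<n. \<theta> i * x i) < b"
    let ?H = "{x. real m * b \<le> (\<Sum>i<n. \<theta> i * x i)} :: (nat \<Rightarrow> real) set"
    define p where "p = measure \<mu> {x. b < (\<Sum>i<n. \<theta> i * x i)}"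
    have p0: "0 \<le> p" by (simp add: p_def)
    have small: "f x < exp (- (8 * real n))" if x: "x \<in> Rn n" "x \<in> ?H" for x
    proof (rule ccontr)
      assume "\<not> ?thesis"
      then have "(\<lambda>i. x i / real m) \<in> G" using c by (simp add: G_def)
      moreover have "(\<lambda>i. x i / real m) \<in> Rn n" using x by (auto simp: Rn_def)
      ultimately have "(\<Sum>i<n. \<theta> i * (x i / real m)) < b" by (rule out)
      then have "(\<Sum>i<n. \<theta> i * x i) < real m * b" using c by (simp add: sum_divide_distrib[symmetric] divide_less_eq mult.commute)
      then show False using x by simp
    qed
    have "ennreal (p ^ m * (vol (real m) / 2)) \<le> (\<integral>\<^sup>+x. ennreal (f x) * indicator ?H x \<partial>lebn n)"
      unfolding p_def f_def by (rule iter_halfspace[OF c])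
    also have "\<dots> \<le> (\<integral>\<^sup>+x. ennreal (exp (- (4 * real n))) * ennreal (sqrt (f x)) \<partial>lebn n)"
    proof (rule nn_integral_mono_AE, rule AE_mp[OF AE_lebn_Rn], rule AE_I2, rule impI)
      fix x assume x: "x \<in> Rn n"
      show "ennreal (f x) * indicator ?H x \<le> ennreal (exp (- (4 * real n))) * ennreal (sqrt (f x))"
      proof (cases "x \<in> ?H")
        case True
        have "sqrt (f x) \<le> sqrt (exp (- (8 * real n)))" using small[OF x True] by simp
        also have "\<dots> = exp (- (4 * real n))"
          by (rule real_sqrt_unique) (auto simp: power2_eq_square exp_add[symmetric])
        finally have "sqrt (f x) * sqrt (f x) \<le> exp (- (4 * real n)) * sqrt (f x)"
          using fD(2) by (intro mult_right_mono) auto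
        then have "f x \<le> exp (- (4 * real n)) * sqrt (f x)" using fD(2) by simp
        then show ?thesis using True by (simp add: ennreal_mult'[symmetric] ennreal_leI)
      qed simp
    qed
    also have "\<dots> = ennreal (exp (- (4 * real n))) * (\<integral>\<^sup>+x. ennreal (sqrt (f x)) \<partial>lebn n)"
      by (rule nn_integral_cmult) measurable
    also have "\<dots> \<le> ennreal (exp (- (4 * real n))) * ennreal (2 ^ n * exp (real n) * vol (real m))"
      unfolding f_def by (intro mult_left_mono iter_sqrt_mass m) auto
    also have "\<dots> = ennreal (exp (- (4 * real n)) * (2 ^ n * exp (real n) * vol (real m)))"
      by (simp add: ennreal_mult'[symmetric])
    finally have "p ^ m * (vol (real m) / 2) \<le> exp (- (4 * real n)) * (2 ^ n * exp (real n) * vol (real m))"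
      using vol_pos[OF c] by (subst (asm) ennreal_le_iff) auto
    also have "\<dots> = (2 * 2 ^ n * exp (- (3 * real n))) * (vol (real m) / 2)"
      by (simp add: exp_add[symmetric])
    finally have "p ^ m \<le> 2 * 2 ^ n * exp (- (3 * real n))"
      using vol_pos[OF c] by (subst (asm) mult_le_cancel_right) auto
    also have "\<dots> \<le> exp (real n) * exp (real n) * exp (- (3 * real n))"
    proof (intro mult_right_mono mult_mono)
      have e: "2 \<le> exp (1::real)" using exp_ge_add_one_self[of 1] by simp
      also have "exp 1 \<le> exp (real n)" using n_pos by simp
      finally show "2 \<le> exp (real n)" .
      have "2 ^ n \<le> exp (1::real) ^ n" using e by (intro power_mono) auto
      then show "2 ^ n \<le> exp (real n)" by (simp add: exp_of_nat_mult[symmetric])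
    qed auto
    also have "\<dots> = exp (- real n)" by (simp add: exp_add[symmetric])
    also have "\<dots> = exp (- (real n / real m)) ^ m" using c by (simp add: exp_of_nat_mult[symmetric])
    finally have "p ^ m \<le> exp (- (real n / real m)) ^ m" .
    then show "measure \<mu> {x. b < (\<Sum>i<n. \<theta> i * x i)} \<le> exp (- (real n / real m))"
      using m unfolding p_def[symmetric] by (subst (asm) power_mono_iff) (auto simp: p0)
  qed
qed

end

section \<open>Convex hulls of random points\<close>

lemma compact_box_Rn: "compact {x \<in> Rn n. \<forall>i<n. \<bar>x i\<bar> \<le> R}"
proof -
  have "compactin (product_topology (\<lambda>_. euclidean) UNIV) (PiE UNIV (\<lambda>i. if i < n then {- R..R} else {0::real}))"
    unfolding compactin_PiE by (auto simp: compactin_euclidean_iff)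
  moreover have "PiE UNIV (\<lambda>i. if i < n then {- R..R} else {0::real}) = {x \<in> Rn n. \<forall>i<n. \<bar>x i\<bar> \<le> R}"
    by (auto simp: Rn_def PiE_UNIV_domain abs_le_iff Pi_iff minus_le_iff split: if_splits)
  ultimately show ?thesis by (simp add: euclidean_product_topology compactin_euclidean_iff)
qed

text \<open>Nearest-point argument: \<open>\<theta>\<close> points from the closest point
  \<open>g0\<close> of \<open>G\<close> to \<open>x\<close>. Moving from \<open>g0\<close> towards
  another point of \<open>G\<close> cannot decrease the distance, which bounds the linear form on
  \<open>G\<close> by its value at \<open>g0\<close>.\<close>

lemma separate_point_closed_convex_Rn:
  assumes G: "closed G"
    and conv: "\<And>u v t. u \<in> G \<Longrightarrow> v \<in> G \<Longrightarrow> 0 < t \<Longrightarrow> t < 1 \<Longrightarrow> (\<lambda>i. t * u i + (1 - t) * v i) \<in> G"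
    and x: "x \<in> Rn n" "x \<notin> G"
  obtains \<theta> b where "\<And>g. g \<in> G \<Longrightarrow> g \<in> Rn n \<Longrightarrow> (\<Sum>i<n. \<theta> i * g i) < b" "b < (\<Sum>i<n. \<theta> i * x i)"
proof (cases "G \<inter> Rn n = {}")
  case True
  \<comment> \<open>There is nothing to separate from, and the zero form exceeds -1 at
    \<open>x\<close>.\<close>
  then show ?thesis by (intro that[of "\<lambda>_. 0" "- 1"]) auto
next
  case False
  then obtain g1 where g1: "g1 \<in> G" "g1 \<in> Rn n" by auto
  define D where "D g = (\<Sum>i<n. (x i - g i)\<^sup>2)" for g :: "nat \<Rightarrow> real"
  have D_cont: "continuous_on A D" for A
    unfolding D_def by (intro continuous_intros continuous_on_subset[OF continuous_on_product_coordinates]) auto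
  \<comment> \<open>The box of radius \<open>R\<close> contains every point of \<open>G\<close> in
    \<open>Rn n\<close> no farther from \<open>x\<close> than \<open>g1\<close>, so a minimiser on
    the compact set \<open>C\<close> is a global one.\<close>
  define R where "R = sqrt (D g1) + (\<Sum>i<n. \<bar>x i\<bar>)"
  define C where "C = {g \<in> Rn n. \<forall>i<n. \<bar>g i\<bar> \<le> R} \<inter> G"
  have "compact C" unfolding C_def by (intro compact_Int_closed compact_box_Rn G)
  have in_C: "g \<in> C" if "g \<in> G" "g \<in> Rn n" "D g \<le> D g1" for g
  proof -
    have "\<bar>g i\<bar> \<le> R" if "i < n" for i
    proof -
      have "(x i - g i)\<^sup>2 \<le> D g" unfolding D_def using that by (intro member_le_sum) auto
      then have "\<bar>x i - g i\<bar> \<le> sqrt (D g1)" using \<open>D g \<le> D g1\<close> by (simp add: real_le_rsqrt)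
      moreover have "\<bar>x i\<bar> \<le> (\<Sum>i<n. \<bar>x i\<bar>)" using that by (intro member_le_sum) auto
      ultimately show ?thesis unfolding R_def by linarith
    qed
    then show ?thesis using that by (simp add: C_def)
  qed
  then have "C \<noteq> {}" using g1 by auto
  from continuous_attains_inf[OF \<open>compact C\<close> this D_cont] obtain g0 where g0: "g0 \<in> C" "\<And>g. g \<in> C \<Longrightarrow> D g0 \<le> D g"
    by auto
  have g0G: "g0 \<in> G" "g0 \<in> Rn n" using g0 by (auto simp: C_def)
  have min: "D g0 \<le> D g" if "g \<in> G" "g \<in> Rn n" for g
    using g0(2)[OF in_C[OF g1 order_refl]] g0(2)[OF in_C[OF that]] by linarith
  define \<theta> where "\<theta> i = x i - g0 i" for i
  have "D g0 \<noteq> 0"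
  proof
    assume "D g0 = 0"
    then have "\<forall>i<n. x i = g0 i" unfolding D_def by (subst (asm) sum_nonneg_eq_0_iff) auto
    then have "x = g0" using x(1) g0G(2) by (auto simp: Rn_def fun_eq_iff) (metis not_le)
    then show False using x(2) g0G by simp
  qed
  then have D0: "0 < D g0" unfolding D_def by (simp add: sum_nonneg less_le)
  have le: "(\<Sum>i<n. \<theta> i * g i) \<le> (\<Sum>i<n. \<theta> i * g0 i)" if g: "g \<in> G" "g \<in> Rn n" for g
  proof -
    define a where "a = (\<Sum>i<n. \<theta> i * (g i - g0 i))"
    define e where "e = (\<Sum>i<n. (g i - g0 i)\<^sup>2)"
    have e0: "0 \<le> e" unfolding e_def by (intro sum_nonneg) auto
    have step: "2 * a \<le> t * e" if t: "0 < t" "t < 1" for t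
    proof -
      have "D g0 \<le> D (\<lambda>i. t * g i + (1 - t) * g0 i)"
        using g g0G t by (intro min conv) (auto simp: Rn_def)
      also have "D (\<lambda>i. t * g i + (1 - t) * g0 i) = (\<Sum>i<n. (x i - g0 i)\<^sup>2 - 2 * t * (\<theta> i * (g i - g0 i)) + t\<^sup>2 * (g i - g0 i)\<^sup>2)"
        unfolding D_def \<theta>_def by (intro sum.cong) (auto simp: power2_eq_square algebra_simps)
      also have "\<dots> = D g0 - 2 * t * a + t\<^sup>2 * e"
        by (simp add: D_def a_def e_def sum.distrib sum_subtractf sum_distrib_left)
      finally have "t * (2 * a) \<le> t * (t * e)" by (simp add: power2_eq_square algebra_simps)
      then show ?thesis using t by simp
    qed
    have "a \<le> 0"
    proof (rule ccontr)
      assume "\<not> a \<le> 0"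
      then have a: "0 < a" by simp
      \<comment> \<open>Chosen so that \<open>t * e \<le> a\<close>, which contradicts
        \<open>2 * a \<le> t * e\<close> for positive \<open>a\<close>.\<close>
      define t where "t = min (1 / 2) (a / (e + 1))"
      have t: "0 < t" "t < 1" using a e0 by (auto simp: t_def min_less_iff_disj)
      have "t * e \<le> a / (e + 1) * e" using e0 by (intro mult_right_mono) (auto simp: t_def)
      also have "\<dots> \<le> a" using a e0 by (simp add: field_simps)
      finally show False using step[OF t] a by simp
    qed
    then show ?thesis by (simp add: a_def right_diff_distrib sum_subtractf)
  qed
  have "(\<Sum>i<n. \<theta> i * x i) = (\<Sum>i<n. \<theta> i * g0 i) + D g0"
    by (simp add: D_def \<theta>_def sum.distrib[symmetric] power2_eq_square algebra_simps)
  \<comment> \<open>Placing the threshold halfway makes the inequality strict on both sides.\<close>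
  then have "(\<Sum>i<n. \<theta> i * g0 i) + D g0 / 2 < (\<Sum>i<n. \<theta> i * x i)" using D0 by simp
  moreover have "(\<Sum>i<n. \<theta> i * g i) < (\<Sum>i<n. \<theta> i * g0 i) + D g0 / 2" if "g \<in> G" "g \<in> Rn n" for g
    using le[OF that] D0 by linarith
  ultimately show ?thesis using that by blast
qed

text \<open>The half-space is one of the convex supersets intersected in
  \<open>convhull\<close>.\<close>

lemma convhull_disjoint_halfspace:
  assumes "\<And>x. x \<in> S \<Longrightarrow> (\<Sum>i<n. \<theta> i * x i) \<le> b" and "x \<in> convhull S"
  shows "(\<Sum>i<n. \<theta> i * x i) \<le> b"
proof -
  let ?C = "{x. (\<Sum>i<n. \<theta> i * x i) \<le> b}"
  have "(\<lambda>i. t * u i + (1 - t) * v i) \<in> ?C" if "u \<in> ?C" "v \<in> ?C" "0 \<le> t" "t \<le> 1" for u v and t :: real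
  proof -
    have "(\<Sum>i<n. \<theta> i * (t * u i + (1 - t) * v i)) = t * (\<Sum>i<n. \<theta> i * u i) + (1 - t) * (\<Sum>i<n. \<theta> i * v i)"
      by (simp add: sum_distrib_left sum.distrib[symmetric] algebra_simps)
    also have "\<dots> \<le> b" using that by (intro convex_bound_le) auto
    finally show ?thesis by simp
  qed
  then have "convhull S \<subseteq> ?C" unfolding convhull_def using assms(1) by (intro Inter_lower) auto
  then show ?thesis using assms(2) by auto
qed

text \<open>Covering the complement of \<open>G\<close> by countably many half-spaces makes the bound a countable sum of
  measurable functions of the sample, so joint measurability of the hull is never needed.\<close>

lemma expected_measure_convhull_le:
  assumes \<mu>: "prob_space \<mu>" "sets \<mu> = sets borel" and \<nu>: "log_concave n \<nu>"
    and G: "closed G"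
    and conv: "\<And>u v t. u \<in> G \<Longrightarrow> v \<in> G \<Longrightarrow> 0 < t \<Longrightarrow> t < 1 \<Longrightarrow> (\<lambda>i. t * u i + (1 - t) * v i) \<in> G"
    and p: "0 \<le> p" "\<And>\<theta> b. (\<And>x. x \<in> G \<Longrightarrow> x \<in> Rn n \<Longrightarrow> (\<Sum>i<n. \<theta> i * x i) < b) \<Longrightarrow>
      measure \<mu> {x. b < (\<Sum>i<n. \<theta> i * x i)} \<le> p"
  shows "(\<integral>X. measure \<nu> (convhull (X ` {..<N})) \<partial>(PiM {..<N} (\<lambda>_. \<mu>))) \<le> measure \<nu> G + real N * p"
proof -
  note \<nu>D = log_concaveD[OF \<nu>]
  interpret \<nu>: prob_space \<nu> by (rule \<nu>D(1))
  interpret \<mu>: prob_space \<mu> by (rule \<mu>(1))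
  note [measurable_cong] = \<nu>D(2) \<mu>(2)
  \<comment> \<open>The half-spaces are open so that Lindelof's theorem extracts a countable
    subcover, while their closed versions miss \<open>G\<close> within \<open>Rn n\<close>, as the
    bound by \<open>p\<close> requires.\<close>
  define \<F> where "\<F> = {U. \<exists>\<theta> b. U = {x. b < (\<Sum>i<n. \<theta> i * x i)} \<and> (\<forall>x\<in>G \<inter> Rn n. (\<Sum>i<n. \<theta> i * x i) < b)}"
  have "open U" if "U \<in> \<F>" for U
    using that unfolding \<F>_def
    by (auto intro!: open_Collect_less continuous_intros continuous_on_product_coordinates)
  then obtain \<F>' where F': "\<F>' \<subseteq> \<F>" "countable \<F>'" "\<Union>\<F>' = \<Union>\<F>"
    using Lindelof by metis
  \<comment> \<open>Adjoining the empty set, obtained from the zero form and threshold 1, makes the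
    countable family nonempty and hence enumerable by the naturals.\<close>
  have "{} \<in> \<F>" unfolding \<F>_def by (auto intro!: exI[of _ "\<lambda>_. 0"] exI[of _ 1])
  define U where "U = from_nat_into (insert {} \<F>')"
  have range_U: "range U = insert {} \<F>'" unfolding U_def using F' by (intro range_from_nat_into) auto
  then have UF: "U j \<in> \<F>" for j using F'(1) \<open>{} \<in> \<F>\<close> by (metis insert_subset rangeI subsetD)
  have U_open: "open (U j)" for j using UF \<open>\<And>U. U \<in> \<F> \<Longrightarrow> open U\<close> by blast
  have cover: "x \<in> G \<or> (\<exists>j. x \<in> U j)" if xR: "x \<in> Rn n" for x
  proof (cases "x \<in> G")
    case False
    obtain \<theta> b where "\<And>g. g \<in> G \<Longrightarrow> g \<in> Rn n \<Longrightarrow> (\<Sum>i<n. \<theta> i * g i) < b" "b < (\<Sum>i<n. \<theta> i * x i)"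
      using separate_point_closed_convex_Rn[OF G conv xR False] by blast
    then have "x \<in> \<Union>\<F>" unfolding \<F>_def by blast
    also have "\<dots> = (\<Union>j. U j)" using range_U F'(3) by auto
    finally show ?thesis by auto
  qed simp
  have U_small: "emeasure \<mu> (U j) \<le> ennreal p" for j
    using UF[of j] p(2) unfolding \<F>_def by (auto simp: \<mu>.emeasure_eq_measure intro!: ennreal_leI)
  have U_hull: "\<exists>i<N. X i \<in> U j" if "x \<in> convhull (X ` {..<N})" "x \<in> U j" for x X j
  proof (rule ccontr)
    assume none: "\<not> ?thesis"
    obtain \<theta> b where U: "U j = {x. b < (\<Sum>i<n. \<theta> i * x i)}" using UF[of j] unfolding \<F>_def by auto
    have "(\<Sum>k<n. \<theta> k * X i k) \<le> b" if "i < N" for i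
    proof -
      have "X i \<notin> U j" using none that by blast
      then show ?thesis by (simp add: U)
    qed
    then have "(\<Sum>i<n. \<theta> i * x i) \<le> b"
      by (intro convhull_disjoint_halfspace[OF _ that(1)]) auto
    then show False using that(2) by (simp add: U)
  qed
  \<comment> \<open>On disjoint pieces the weights \<open>emeasure \<nu> (E j)\<close> sum to at
    most 1, so infinitely many half-spaces together cost no more than \<open>N * p\<close>.\<close>
  define E where "E = disjointed U"
  have [measurable]: "U j \<in> sets borel" for j using U_open by (rule borel_open)
  have [measurable]: "E j \<in> sets borel" for j
  proof -
    have "range U \<subseteq> sets borel" using U_open by auto
    from sets.range_disjointed_sets[OF this] show ?thesis by (auto simp: E_def)
  qed
  have [measurable]: "G \<in> sets borel" using G by (rule borel_closed)
  have EU: "E j \<subseteq> U j" for j unfolding E_def by (rule disjointed_subset)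
  have UN_E: "(\<Union>j. E j) = (\<Union>j. U j)" unfolding E_def by (rule UN_disjointed_eq)
  have sum_E: "(\<Sum>j. emeasure \<nu> (E j)) \<le> 1"
  proof -
    have "(\<Sum>j. emeasure \<nu> (E j)) = emeasure \<nu> (\<Union>j. E j)"
    proof (rule suminf_emeasure)
      show "range E \<subseteq> sets \<nu>" by (auto simp: \<nu>D(2))
      show "disjoint_family E" unfolding E_def by (rule disjoint_family_disjointed)
    qed
    then show ?thesis using \<nu>.measure_le_1 by simp
  qed
  \<comment> \<open>A hull that meets \<open>E j\<close> also meets \<open>U j\<close> and so has a
    sample point in \<open>U j\<close>; the inner sum is then at least 1 and pays for all of
    \<open>E j\<close>.\<close>
  define B where "B X = emeasure \<nu> G + (\<Sum>j. emeasure \<nu> (E j) * (\<Sum>i<N. indicator (U j) (X i)))" for X :: "nat \<Rightarrow> nat \<Rightarrow> real"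
  have bound: "ennreal (measure \<nu> (convhull (X ` {..<N}))) \<le> B X" for X
  \<comment> \<open>A nonmeasurable hull has \<open>measure\<close> 0 by convention, so the bound is
    trivial there.\<close>
  proof (cases "convhull (X ` {..<N}) \<in> sets \<nu>")
    case True
    let ?C = "convhull (X ` {..<N})"
    let ?E = "\<lambda>j. if ?C \<inter> E j = {} then {} else E j"
    have "emeasure \<nu> ?C = emeasure \<nu> (?C \<inter> Rn n)"
      using True \<nu>D(5)[of ?C] by (simp add: \<nu>.emeasure_eq_measure \<nu>D(2))
    also have "\<dots> \<le> emeasure \<nu> (G \<union> (\<Union>j. ?E j))"
    proof (rule emeasure_mono)
      show "?C \<inter> Rn n \<subseteq> G \<union> (\<Union>j. ?E j)"
      proof
        fix x assume x: "x \<in> ?C \<inter> Rn n"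
        show "x \<in> G \<union> (\<Union>j. ?E j)"
        proof (cases "x \<in> G")
          case False
          then have "x \<in> (\<Union>j. E j)" using cover[of x] x UN_E by auto
          then obtain j where "x \<in> E j" by auto
          then have "x \<in> ?E j" using x by auto
          then show ?thesis by blast
        qed simp
      qed
    qed (simp add: \<nu>D(2))
    also have "\<dots> \<le> emeasure \<nu> G + emeasure \<nu> (\<Union>j. ?E j)"
      by (rule emeasure_subadditive) (auto simp: \<nu>D(2))
    also have "emeasure \<nu> (\<Union>j. ?E j) \<le> (\<Sum>j. emeasure \<nu> (?E j))"
      by (rule emeasure_subadditive_countably) (auto simp: \<nu>D(2))
    also have "\<dots> \<le> (\<Sum>j. emeasure \<nu> (E j) * (\<Sum>i<N. indicator (U j) (X i)))"
    proof (rule suminf_le)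
      fix j
      show "emeasure \<nu> (?E j) \<le> emeasure \<nu> (E j) * (\<Sum>i<N. indicator (U j) (X i))"
      proof (cases "?C \<inter> E j = {}")
        case False
        then obtain i where i: "i < N" "X i \<in> U j" using U_hull EU by blast
        have "(1::ennreal) = indicator (U j) (X i)" using i by simp
        also have "\<dots> \<le> (\<Sum>i<N. indicator (U j) (X i))" using i by (intro member_le_sum) auto
        finally have "emeasure \<nu> (E j) * 1 \<le> emeasure \<nu> (E j) * (\<Sum>i<N. indicator (U j) (X i))" by (rule mult_left_mono) simp
        then show ?thesis using False by simp
      qed simp
    qed auto
    finally show ?thesis by (simp add: B_def \<nu>.emeasure_eq_measure add_left_mono)
  qed (simp add: measure_notin_sets)
  let ?P = "PiM {..<N} (\<lambda>_. \<mu>)"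
  have comp: "(\<integral>\<^sup>+X. indicator (U j) (X i) \<partial>?P) \<le> ennreal p" if "i < N" for i j
  proof -
    have "(\<integral>\<^sup>+X. indicator (U j) (X i) \<partial>?P) = (\<integral>\<^sup>+x. indicator (U j) x \<partial>distr ?P \<mu> (\<lambda>X. X i))"
      using that by (subst nn_integral_distr) auto
    also have "distr ?P \<mu> (\<lambda>X. X i) = \<mu>"
      using that \<mu>(1) by (intro distr_PiM_component) auto
    also have "(\<integral>\<^sup>+x. indicator (U j) x \<partial>\<mu>) = emeasure \<mu> (U j)" by (simp add: \<mu>(2))
    finally show ?thesis using U_small by simp
  qed
  interpret P: prob_space ?P by (intro prob_space_PiM \<mu>(1))
  have "(\<integral>\<^sup>+X. B X \<partial>?P) = emeasure \<nu> G + (\<Sum>j. emeasure \<nu> (E j) * (\<Sum>i<N. \<integral>\<^sup>+X. indicator (U j) (X i) \<partial>?P))"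
    unfolding B_def
    by (simp add: nn_integral_add nn_integral_suminf nn_integral_cmult nn_integral_sum P.emeasure_space_1)
  also have "\<dots> \<le> emeasure \<nu> G + (\<Sum>j. emeasure \<nu> (E j) * (\<Sum>i<N. ennreal p))"
    by (intro add_left_mono suminf_le mult_left_mono sum_mono comp) auto
  also have "\<dots> = emeasure \<nu> G + (\<Sum>j. emeasure \<nu> (E j)) * (of_nat N * ennreal p)"
    by (simp add: ennreal_suminf_multc)
  also have "\<dots> \<le> emeasure \<nu> G + 1 * (of_nat N * ennreal p)"
    by (intro add_left_mono mult_right_mono sum_E) auto
  also have "\<dots> = ennreal (measure \<nu> G + real N * p)"
    using p(1) by (simp add: \<nu>.emeasure_eq_measure ennreal_mult ennreal_of_nat_eq_real_of_nat)
  finally have intB: "(\<integral>\<^sup>+X. B X \<partial>?P) \<le> ennreal (measure \<nu> G + real N * p)" .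
  show ?thesis
  \<comment> \<open>A nonintegrable function has Bochner integral 0 by convention, and the right
    side is nonnegative.\<close>
  proof (cases "integrable ?P (\<lambda>X. measure \<nu> (convhull (X ` {..<N})))")
    case True
    then have "ennreal (\<integral>X. measure \<nu> (convhull (X ` {..<N})) \<partial>?P) = (\<integral>\<^sup>+X. ennreal (measure \<nu> (convhull (X ` {..<N}))) \<partial>?P)"
      by (intro nn_integral_eq_integral[symmetric]) auto
    also have "\<dots> \<le> ennreal (measure \<nu> G + real N * p)"
      using nn_integral_mono[OF bound] intB by (rule order_trans)
    finally show ?thesis using p(1) by (subst (asm) ennreal_le_iff) auto
  qed (use p(1) in \<open>simp add: not_integrable_integral_eq\<close>)
qed

section \<open>Whitening and the main estimate\<close>

text \<open>Gram-Schmidt on the unit vectors for the bilinear form \<open>B\<close> of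
  \<open>S\<close>. Only multiples of earlier rows are subtracted, so the rows stay unit lower
  triangular, and positive definiteness keeps each \<open>B w w\<close> positive.\<close>

lemma ldl_decomposition:
  fixes S :: "nat \<Rightarrow> nat \<Rightarrow> real"
  assumes sym: "\<And>i j. S i j = S j i"
    and pd: "\<And>v. \<exists>i<n. v i \<noteq> 0 \<Longrightarrow> 0 < (\<Sum>i<n. \<Sum>j<n. v i * v j * S i j)"
  obtains L d where "\<And>j. 0 < d j" "\<And>j. L j j = 1" "\<And>i j. j < i \<Longrightarrow> L j i = 0"
    "\<And>j k. j < n \<Longrightarrow> k < n \<Longrightarrow> (\<Sum>i<n. \<Sum>i'<n. L j i * L k i' * S i i') = (if j = k then d j else 0)"
proof -
  define B where "B u v = (\<Sum>i<n. \<Sum>i'<n. u i * v i' * S i i')" for u v :: "nat \<Rightarrow> real"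
  have B_sym: "B u v = B v u" for u v
    unfolding B_def by (subst sum.swap) (simp add: sym mult_ac)
  have B_diff: "B (\<lambda>i. u i - (\<Sum>j\<in>A. c j * w j i)) v = B u v - (\<Sum>j\<in>A. c j * B (w j) v)" for u v c w and A :: "nat set"
  proof -
    have "(\<Sum>i<n. \<Sum>i'<n. (\<Sum>j\<in>A. c j * w j i) * v i' * S i i') = (\<Sum>i<n. \<Sum>i'<n. \<Sum>j\<in>A. c j * (w j i * v i' * S i i'))"
      by (simp add: sum_distrib_right sum_distrib_left mult_ac)
    also have "\<dots> = (\<Sum>j\<in>A. \<Sum>i<n. \<Sum>i'<n. c j * (w j i * v i' * S i i'))"
      by (subst sum.swap, subst (2) sum.swap, rule refl)
    also have "\<dots> = (\<Sum>j\<in>A. c j * B (w j) v)"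
      by (simp add: B_def sum_distrib_left)
    finally show ?thesis unfolding B_def by (simp add: left_diff_distrib sum_subtractf)
  qed
  have "\<exists>L d. (\<forall>j<m. 0 < d j \<and> L j j = 1 \<and> (\<forall>i>j. L j i = 0)) \<and> (\<forall>j<m. \<forall>k<m. B (L j) (L k) = (if j = k then d j else 0))"
    if "m \<le> n" for m
    using that
  proof (induction m)
    case (Suc m)
    then obtain L d where L0: "\<forall>j<m. 0 < d j \<and> L j j = 1 \<and> (\<forall>i>j. L j i = 0)"
      and orth: "\<forall>j<m. \<forall>k<m. B (L j) (L k) = (if j = k then d j else 0)"
      by auto
    then have L: "\<And>j. j < m \<Longrightarrow> 0 < d j" "\<And>j. j < m \<Longrightarrow> L j j = 1" "\<And>i j. j < m \<Longrightarrow> j < i \<Longrightarrow> L j i = 0"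
      by auto
    define e :: "nat \<Rightarrow> real" where "e i = (if i = m then 1 else 0)" for i
    define w where "w i = e i - (\<Sum>j<m. B e (L j) / d j * L j i)" for i
    have w0: "w m = 1" "\<And>i. m < i \<Longrightarrow> w i = 0"
      using L(3) by (auto simp: w_def e_def intro!: sum.neutral)
    have wL: "B w (L k) = 0" if "k < m" for k
    proof -
      have "B w (L k) = B e (L k) - (\<Sum>j<m. B e (L j) / d j * B (L j) (L k))"
        unfolding w_def by (rule B_diff)
      also have "(\<Sum>j<m. B e (L j) / d j * B (L j) (L k)) = (\<Sum>j<m. if j = k then B e (L k) else 0)"
        using that L(1)[OF that] by (intro sum.cong) (auto simp: orth)
      finally show ?thesis using that by simp
    qed
    have "\<exists>i<n. w i \<noteq> 0" using w0(1) Suc.prems by (intro exI[of _ m]) auto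
    then have "0 < B w w" unfolding B_def by (rule pd)
    then show ?case using L orth w0 wL B_sym
      by (intro exI[of _ "L(m := w)"] exI[of _ "d(m := B w w)"]) (auto simp: less_Suc_eq)
  qed auto
  from this[OF order_refl] obtain L d where L: "\<forall>j<n. 0 < d j \<and> L j j = 1 \<and> (\<forall>i>j. L j i = 0)"
    and orth: "\<forall>j<n. \<forall>k<n. B (L j) (L k) = (if j = k then d j else 0)"
    by auto
  show ?thesis
    \<comment> \<open>Beyond \<open>n\<close> the data are extended by the identity, so that the
      conditions without index bounds hold everywhere.\<close>
    by (rule that[of "\<lambda>j. if j < n then d j else 1" "\<lambda>j i. if j < n then L j i else if i = j then 1 else 0"])
      (use L orth in \<open>auto simp: B_def\<close>)
qed

lemma detn_eq_det: "detn n M = det (mat n n (\<lambda>(i, j). M i j))"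
  unfolding detn_def det_def
  by (auto simp: lessThan_atLeast0 dest: permutes_in_image intro!: sum.cong prod.cong)

text \<open>Take determinants in \<open>L S L^T = D\<close>, where the unit triangular
  \<open>L\<close> has determinant 1.\<close>

lemma detn_ldl:
  fixes L S :: "nat \<Rightarrow> nat \<Rightarrow> real"
  assumes L: "\<And>j. L j j = 1" "\<And>i j. j < i \<Longrightarrow> L j i = 0"
    and orth: "\<And>j k. j < n \<Longrightarrow> k < n \<Longrightarrow> (\<Sum>i<n. \<Sum>i'<n. L j i * L k i' * S i i') = (if j = k then d j else 0)"
  shows "detn n S = (\<Prod>j<n. d j)"
proof -
  let ?L = "mat n n (\<lambda>(i, j). L i j)" and ?S = "mat n n (\<lambda>(i, j). S i j)"
  let ?D = "mat n n (\<lambda>(i, j). if i = j then d i else 0)"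
  have C: "?L \<in> carrier_mat n n" "?S \<in> carrier_mat n n" "?D \<in> carrier_mat n n" by auto
  have "det ?L = 1"
    by (subst det_lower_triangular[OF _ C(1)]) (auto simp: L prod_list_diag_prod)
  have "det ?D = (\<Prod>j<n. d j)"
    by (subst det_lower_triangular[OF _ C(3)]) (auto simp: prod_list_diag_prod lessThan_atLeast0)
  moreover have "?L * ?S * transpose_mat ?L = ?D"
  proof (rule eq_matI)
    fix j k assume "j < dim_row ?D" "k < dim_col ?D"
    then have jk: "j < n" "k < n" by auto
    have "(?L * ?S * transpose_mat ?L) $$ (j, k) = (\<Sum>i'<n. (\<Sum>i<n. L j i * S i i') * L k i')"
      using jk by (simp add: scalar_prod_def lessThan_atLeast0)
    also have "\<dots> = (\<Sum>i<n. \<Sum>i'<n. L j i * L k i' * S i i')"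
      by (subst sum.swap) (simp add: sum_distrib_right sum_distrib_left mult_ac)
    finally show "(?L * ?S * transpose_mat ?L) $$ (j, k) = ?D $$ (j, k)" using orth[OF jk] jk by simp
  qed auto
  moreover have "det (?L * ?S * transpose_mat ?L) = det ?L * det ?S * det ?L"
    using det_mult[OF mult_carrier_mat[OF C(1,2)] transpose_carrier_mat[THEN iffD2, OF C(1)]]
      det_mult[OF C(1,2)] det_transpose[OF C(1)] by simp
  ultimately show ?thesis using \<open>det ?L = 1\<close> by (simp add: detn_eq_det)
qed

text \<open>The default values are 0: without a density \<open>RN_deriv\<close> is the zero
  function, and \<open>enn2real\<close> sends infinity to 0. A nonzero \<open>dens_sup\<close>
  therefore certifies a genuine density that is almost everywhere bounded by it.\<close>

lemma nn_integral_le_dens_sup: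
  assumes nz: "dens_sup n \<nu> \<noteq> 0" and [measurable]: "g \<in> borel_measurable borel"
  shows "(\<integral>\<^sup>+x. g x \<partial>\<nu>) \<le> ennreal (dens_sup n \<nu>) * (\<integral>\<^sup>+x. g x \<partial>lebn n)"
proof -
  let ?P = "\<lambda>f. f \<in> borel_measurable (lebn n) \<and> density (lebn n) f = \<nu>"
  define E where "E = esssup (lebn n) (dens n \<nu>)"
  have ex: "\<exists>f. ?P f"
  proof (rule ccontr)
    assume "\<not> ?thesis"
    then have "dens n \<nu> = (\<lambda>_. 0)" unfolding dens_def RN_deriv_def by (auto simp: fun_eq_iff)
    then have "E \<le> 0" unfolding E_def by (intro esssup_I) auto
    then show False using nz by (simp add: dens_sup_def E_def[symmetric])
  qed
  have P: "?P (dens n \<nu>)"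
    using someI_ex[of ?P, OF ex] ex unfolding dens_def RN_deriv_def by (simp only: if_True)
  then have [measurable]: "dens n \<nu> \<in> borel_measurable (lebn n)" by blast
  have "E \<noteq> \<top>" using nz by (auto simp: dens_sup_def E_def[symmetric])
  then have "E < \<top>" by (simp add: less_top)
  then have E: "E = ennreal (dens_sup n \<nu>)" by (simp add: dens_sup_def E_def[symmetric])
  have "(\<integral>\<^sup>+x. g x \<partial>\<nu>) = (\<integral>\<^sup>+x. dens n \<nu> x * g x \<partial>lebn n)"
    using P by (subst nn_integral_density[symmetric]) auto
  also have "\<dots> \<le> (\<integral>\<^sup>+x. E * g x \<partial>lebn n)"
    using esssup_AE[of "dens n \<nu>" "lebn n"] unfolding E_def[symmetric]
    by (intro nn_integral_mono_AE) (auto elim!: eventually_mono intro!: mult_right_mono)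
  also have "\<dots> = E * (\<integral>\<^sup>+x. g x \<partial>lebn n)" by (rule nn_integral_cmult) measurable
  finally show ?thesis by (simp add: E)
qed

lemma covariance_quadratic_form:
  assumes lc: "log_concave n \<mu>" and cen: "centered n \<mu>"
  shows "integrable \<mu> (\<lambda>x. (\<Sum>i<n. u i * x i) * (\<Sum>j<n. v j * x j))"
    "(\<integral>x. (\<Sum>i<n. u i * x i) * (\<Sum>j<n. v j * x j) \<partial>\<mu>) = (\<Sum>i<n. \<Sum>j<n. u i * v j * cov \<mu> i j)"
proof -
  have eq: "(\<Sum>i<n. u i * x i) * (\<Sum>j<n. v j * x j) = (\<Sum>i<n. \<Sum>j<n. u i * v j * (x i * x j))" for x :: "nat \<Rightarrow> real"
    by (simp add: sum_product mult_ac)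
  have cov: "cov \<mu> i j = (\<integral>x. x i * x j \<partial>\<mu>)" if "i < n" for i j
    using cen that by (simp add: cov_def centered_def)
  show "integrable \<mu> (\<lambda>x. (\<Sum>i<n. u i * x i) * (\<Sum>j<n. v j * x j))"
    unfolding eq by (intro Bochner_Integration.integrable_sum integrable_mult_right log_concave_product_integrable[OF lc])
  have "(\<integral>x. (\<Sum>i<n. u i * x i) * (\<Sum>j<n. v j * x j) \<partial>\<mu>) = (\<Sum>i<n. \<Sum>j<n. u i * v j * (\<integral>x. x i * x j \<partial>\<mu>))"
    unfolding eq
    by (subst Bochner_Integration.integral_sum,
        intro Bochner_Integration.integrable_sum integrable_mult_right log_concave_product_integrable[OF lc],
        subst Bochner_Integration.integral_sum,
        intro integrable_mult_right log_concave_product_integrable[OF lc]) simp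
  then show "(\<integral>x. (\<Sum>i<n. u i * x i) * (\<Sum>j<n. v j * x j) \<partial>\<mu>) = (\<Sum>i<n. \<Sum>j<n. u i * v j * cov \<mu> i j)"
    by (simp add: cov)
qed

text \<open>The form is the second moment of the linear functional \<open>v\<close>. If it were 0,
  the functional would vanish almost everywhere and a hyperplane would have full measure, which
  \<open>log_concave\<close> excludes.\<close>

lemma covariance_pos_def:
  assumes lc: "log_concave n \<mu>" and cen: "centered n \<mu>" and v: "\<exists>i<n. v i \<noteq> 0"
  shows "0 < (\<Sum>i<n. \<Sum>j<n. v i * v j * cov \<mu> i j)"
proof (rule ccontr)
  note lcD = log_concaveD[OF lc]
  interpret prob_space \<mu> by (rule lcD(1))
  note cq = covariance_quadratic_form[OF lc cen, of v v]
  let ?H = "{x \<in> Rn n. (\<Sum>i<n. v i * x i) = 0}"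
  assume "\<not> ?thesis"
  then have "(\<integral>x. (\<Sum>i<n. v i * x i) * (\<Sum>j<n. v j * x j) \<partial>\<mu>) \<le> 0" using cq(2) by simp
  moreover have "0 \<le> (\<integral>x. (\<Sum>i<n. v i * x i) * (\<Sum>j<n. v j * x j) \<partial>\<mu>)" by (simp add: integral_nonneg_AE)
  ultimately have "(\<integral>x. (\<Sum>i<n. v i * x i) * (\<Sum>j<n. v j * x j) \<partial>\<mu>) = 0" by simp
  then have "AE x in \<mu>. (\<Sum>i<n. v i * x i) * (\<Sum>j<n. v j * x j) = 0"
    using integral_nonneg_eq_0_iff_AE[OF cq(1)] by simp
  with lcD(4) have "AE x in \<mu>. x \<in> ?H" by eventually_elim simp
  moreover have "?H \<in> sets \<mu>"
  proof -
    have "?H = Rn n \<inter> {x. (\<Sum>i<n. v i * x i) = 0}" by auto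
    also have "\<dots> \<in> sets borel" by measurable
    finally show ?thesis by (simp add: lcD(2))
  qed
  ultimately have "measure \<mu> ?H = 1" by (simp add: prob_eq_1)
  moreover have "hyperplane n ?H" unfolding hyperplane_def using v by blast
  then have "measure \<mu> ?H < 1" using lc unfolding log_concave_def by blast
  ultimately show False by simp
qed

lemma whitening:
  assumes n: "1 \<le> n" and lc: "log_concave n \<mu>" and cen: "centered n \<mu>"
  obtains L d where "whitened_log_concave n \<mu> L d" "detn n (cov \<mu>) = (\<Prod>j<n. d j)"
proof -
  have sym: "cov \<mu> i j = cov \<mu> j i" for i j by (simp add: cov_def mult.commute)
  show ?thesis
  proof (rule ldl_decomposition[OF sym covariance_pos_def[OF lc cen]])
    fix L :: "nat \<Rightarrow> nat \<Rightarrow> real" and d :: "nat \<Rightarrow> real"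
    assume Ld: "\<And>j. 0 < d j" "\<And>j. L j j = 1" "\<And>i j. j < i \<Longrightarrow> L j i = 0"
      and orth: "\<And>j k. j < n \<Longrightarrow> k < n \<Longrightarrow> (\<Sum>i<n. \<Sum>i'<n. L j i * L k i' * cov \<mu> i i') = (if j = k then d j else 0)"
    show ?thesis
    proof (rule that)
      show "detn n (cov \<mu>) = (\<Prod>j<n. d j)" by (rule detn_ldl[OF Ld(2,3) orth])
      show "whitened_log_concave n \<mu> L d"
      proof
        fix j assume "j < n"
        then show "(\<integral>x. (\<Sum>i<n. L j i * x i)\<^sup>2 \<partial>\<mu>) = d j"
          using covariance_quadratic_form(2)[OF lc cen, of "L j" "L j"] orth[of j j] by (simp add: power2_eq_square)
      qed (use assms Ld in auto)
    qed
  qed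
qed

section \<open>Calibrating the constants against the isotropic constant\<close>

context whitened_log_concave
begin

text \<open>\<open>exp_mean_le\<close> at the origin bounds the mean of \<open>exp (- q)\<close>
  below by e^(-n), and the density bound makes it at most \<open>dens_sup n \<mu> * vol 1\<close>,
  which is \<open>(sqrt pi * l) ^ n\<close>. The \<open>n\<close>-th root and
  \<open>sqrt pi \<le> exp 1\<close> finish.\<close>

lemma isotropic_const_lower_bound:
  assumes l: "0 < l" "l ^ n = dens_sup n \<mu> * sqrt (\<Prod>j<n. d j)" and M: "dens_sup n \<mu> \<noteq> 0"
  shows "exp (- 2) \<le> l"
proof -
  have M0: "0 \<le> dens_sup n \<mu>" by (simp add: dens_sup_def)
  have "q (\<lambda>i. 0) = 0" by (simp add: q_def y_def)
  then have "ennreal (exp (- real n)) \<le> (\<integral>\<^sup>+z. ennreal (exp (- (q z / 1))) \<partial>\<mu>)"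
    using exp_mean_le[of 1 "\<lambda>_. 0"] by simp
  also have "\<dots> \<le> ennreal (dens_sup n \<mu>) * (\<integral>\<^sup>+z. ennreal (exp (- (q z / 1))) \<partial>lebn n)"
    by (rule nn_integral_le_dens_sup[OF M]) measurable
  also have "\<dots> = ennreal (dens_sup n \<mu> * vol 1)"
    using M0 by (subst nn_integral_gauss) (auto simp: ennreal_mult')
  finally have "exp (- real n) \<le> dens_sup n \<mu> * vol 1"
    using M0 vol_pos[of 1] by (subst (asm) ennreal_le_iff) auto
  also have "\<dots> = (sqrt pi * l) ^ n" by (simp add: vol_def power_mult_distrib l(2))
  finally have "exp (- 1) ^ n \<le> (sqrt pi * l) ^ n" by (simp add: exp_of_nat_mult[symmetric])
  then have "exp (- 1) \<le> sqrt pi * l" using n_pos l by (subst (asm) power_mono_iff) auto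
  also have "\<dots> \<le> exp 1 * l"
  proof (rule mult_right_mono)
    have "sqrt pi \<le> sqrt (2\<^sup>2)" using pi_less_4 by (intro real_sqrt_le_mono) simp
    also have "\<dots> \<le> exp 1" using exp_ge_add_one_self[of 1] by simp
    finally show "sqrt pi \<le> exp 1" .
  qed (use l in simp)
  finally have "exp (- 1) * exp (- 1) \<le> exp (- 1) * (exp 1 * l)" by (intro mult_left_mono) auto
  moreover have "exp (- 1) * exp 1 = (1::real)" by (simp add: exp_add[symmetric])
  ultimately show ?thesis by (simp add: exp_add[symmetric] mult.assoc[symmetric])
qed

text \<open>The density bound for \<open>\<nu>\<close> times the volume of \<open>G\<close> is the
  \<open>n\<close>-th power of \<open>exp 8 * sqrt pi * l / sqrt m\<close>. With
  \<open>sqrt pi \<le> exp 1\<close> and \<open>m\<close> at least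
  \<open>exp 20 * l\<^sup>2\<close>, the base is at most e^(8 + 1 - 10).\<close>

lemma depth_region_measure:
  assumes l: "0 < l" "l ^ n = M * sqrt (\<Prod>j<n. d j)" and M: "0 < M" "dens_sup n \<nu> = M"
    and m: "1 \<le> (m::nat)" "exp 20 * l\<^sup>2 \<le> real m" and \<nu>: "prob_space \<nu>" "sets \<nu> = sets borel"
    and G: "G \<in> sets borel" "emeasure (lebn n) G \<le> ennreal (exp (8 * real n) * vol (real m) / real m ^ n)"
  shows "measure \<nu> G \<le> exp (- real n)"
proof -
  interpret \<nu>: prob_space \<nu> by (rule \<nu>(1))
  have c: "0 < real m" using m by simp
  have sqm: "0 < sqrt (real m)" using c by simp
  have sq: "exp 10 * l \<le> sqrt (real m)"
    using m(2) by (intro real_le_rsqrt) (simp add: power_mult_distrib exp_double[symmetric])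
  have base: "exp 8 * sqrt (pi * real m) * l / real m \<le> exp (- 1)"
  proof -
    have "sqrt pi \<le> sqrt (2\<^sup>2)" using pi_less_4 by (intro real_sqrt_le_mono) simp
    also have "\<dots> \<le> exp 1" using exp_ge_add_one_self[of 1] by simp
    finally have pi: "sqrt pi \<le> exp 1" .
    have "exp 8 * sqrt (pi * real m) * l / real m = exp 8 * sqrt pi * (l / sqrt (real m))"
      using c by (simp add: real_sqrt_mult real_div_sqrt field_simps)
    also have "\<dots> \<le> exp 8 * exp 1 * exp (- 10)"
    proof (intro mult_mono pi)
      show "l / sqrt (real m) \<le> exp (- 10)"
        using sq sqm by (simp add: exp_minus field_simps)
    qed (use l c in auto)
    also have "\<dots> = exp (- 1)" by (simp add: exp_add[symmetric])
    finally show ?thesis .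
  qed
  have "ennreal (measure \<nu> G) = (\<integral>\<^sup>+x. indicator G x \<partial>\<nu>)" using G \<nu> by (simp add: \<nu>.emeasure_eq_measure)
  also have "\<dots> \<le> ennreal M * (\<integral>\<^sup>+x. indicator G x \<partial>lebn n)"
    using nn_integral_le_dens_sup[of n \<nu> "indicator G"] M G by simp
  also have "\<dots> \<le> ennreal M * ennreal (exp (8 * real n) * vol (real m) / real m ^ n)"
    using G by (intro mult_left_mono) auto
  also have "\<dots> = ennreal (M * (exp (8 * real n) * vol (real m) / real m ^ n))"
    using M by (intro ennreal_mult'[symmetric]) simp
  finally have "measure \<nu> G \<le> M * (exp (8 * real n) * vol (real m) / real m ^ n)"
    using M vol_pos[OF c] by (subst (asm) ennreal_le_iff) auto
  also have "\<dots> = (exp 8 * sqrt (pi * real m) * l / real m) ^ n"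
    by (simp add: power_mult_distrib power_divide l(2) vol_def exp_of_nat_mult[symmetric] mult_ac)
  also have "\<dots> \<le> exp (- 1) ^ n" using l c by (intro power_mono base) auto
  also have "\<dots> = exp (- real n)" by (simp add: exp_of_nat_mult[symmetric])
  finally show ?thesis .
qed

end

theorem theorem5p4:
  shows "\<exists>c1 c2 :: real. c1 > 0 \<and> c2 > 0 \<and>
    (\<forall>n::nat. \<forall>\<mu> \<nu> :: (nat \<Rightarrow> real) measure. \<forall>N::nat.
      n \<ge> 1 \<longrightarrow> log_concave n \<mu> \<longrightarrow> log_concave n \<nu> \<longrightarrow>
      centered n \<mu> \<longrightarrow> centered n \<nu> \<longrightarrow> dens_sup n \<mu> = dens_sup n \<nu> \<longrightarrow>
      n < N \<longrightarrow> real N \<le> exp (c1 * real n / (isotropic_const n \<mu>)\<^sup>2) \<longrightarrow>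
      (\<integral>X. measure \<nu> (convhull (X ` {..<N})) \<partial>(PiM {..<N} (\<lambda>_. \<mu>)))
        \<le> 2 * exp (- c2 * real n / (isotropic_const n \<mu>)\<^sup>2))"
proof -
  \<comment> \<open>The integer \<open>m\<close> below is at most
    \<open>2 * exp 20 * l\<^sup>2\<close>, so the depth exponent \<open>n / m\<close> is at least
    \<open>2 * c * n / l\<^sup>2\<close>. One half of it compensates \<open>N\<close>, the other
    half is the final decay.\<close>
  define c :: real where "c = 1 / (4 * exp 20)"
  have c0: "0 < c" by (simp add: c_def)
  have main: "(\<integral>X. measure \<nu> (convhull (X ` {..<N})) \<partial>(PiM {..<N} (\<lambda>_. \<mu>))) \<le> 2 * exp (- c * real n / (isotropic_const n \<mu>)\<^sup>2)"
    if n: "1 \<le> n" and lc_mu: "log_concave n \<mu>" and lc_nu: "log_concave n \<nu>" and cen: "centered n \<mu>"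
      and sup: "dens_sup n \<mu> = dens_sup n \<nu>" and N: "n < N" "real N \<le> exp (c * real n / (isotropic_const n \<mu>)\<^sup>2)"
    for n N :: nat and \<mu> \<nu> :: "(nat \<Rightarrow> real) measure"
  proof -
    define l where "l = isotropic_const n \<mu>"
    define M where "M = dens_sup n \<mu>"
    obtain L d where W: "whitened_log_concave n \<mu> L d" and det: "detn n (cov \<mu>) = (\<Prod>j<n. d j)"
      using whitening[OF n lc_mu cen] by blast
    interpret whitened_log_concave n \<mu> L d by (rule W)
    have D: "0 < (\<Prod>j<n. d j)" by (simp add: d_pos prod_pos)
    have l_eq: "l = M powr (1 / real n) * (\<Prod>j<n. d j) powr (1 / (2 * real n))"
      by (simp add: l_def isotropic_const_def M_def det)
    have "M \<noteq> 0"
    proof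
      \<comment> \<open>\<open>M = 0\<close> is the junk value of a measure without bounded density; then \<open>l = 0\<close> and \<open>N \<le> exp 0\<close>.\<close>
      assume "M = 0"
      then have "l = 0" by (simp add: l_eq)
      then show False using N n by (simp add: l_def[symmetric])
    qed
    then have M: "0 < M" unfolding M_def dens_sup_def by (simp add: less_le)
    have l0: "0 < l" unfolding l_eq using M D by (intro mult_pos_pos) (auto simp: less_imp_neq[OF d_pos, symmetric])
    have "(M powr (1 / real n) * D powr (1 / (2 * real n))) ^ n = M * sqrt D" if "0 < D" for D
    proof -
      have "(M powr (1 / real n) * D powr (1 / (2 * real n))) ^ n =
          (M powr (1 / real n)) powr real n * (D powr (1 / (2 * real n))) powr real n"
        using M that by (simp add: power_mult_distrib powr_realpow)
      also have "\<dots> = M * sqrt D"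
        using M that n by (simp add: powr_powr powr_half_sqrt)
      finally show ?thesis .
    qed
    from this[OF D] have ln: "l ^ n = M * sqrt (\<Prod>j<n. d j)" unfolding l_eq .
    \<comment> \<open>This keeps \<open>exp 20 * l\<^sup>2\<close> at least 1, so that rounding it
      up to the integer \<open>m\<close> at most doubles it, and it also gives
      \<open>c * n / l\<^sup>2 \<le> n\<close>.\<close>
    have l_ge: "exp (- 2) \<le> l"
      using isotropic_const_lower_bound[OF l0] ln \<open>M \<noteq> 0\<close> by (simp add: M_def)
    then have "exp (- 2) ^ 2 \<le> l\<^sup>2" by (intro power_mono) auto
    then have l2: "exp (- 4) \<le> l\<^sup>2" by (simp add: exp_double[symmetric])
    have big: "1 \<le> exp 20 * l\<^sup>2"
    proof -
      have "(1::real) \<le> exp 20 * exp (- 4)" by (simp add: exp_add[symmetric])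
      also have "\<dots> \<le> exp 20 * l\<^sup>2" using l2 by simp
      finally show ?thesis .
    qed
    define m where "m = nat \<lceil>exp 20 * l\<^sup>2\<rceil>"
    have m_real: "real m = of_int \<lceil>exp 20 * l\<^sup>2\<rceil>" using big by (simp add: m_def)
    have m_ge: "exp 20 * l\<^sup>2 \<le> real m" unfolding m_real by (rule le_of_int_ceiling)
    have m_le: "real m \<le> 2 * (exp 20 * l\<^sup>2)" unfolding m_real using big ceiling_correct[of "exp 20 * l\<^sup>2"] by linarith
    have m1: "1 \<le> m" using big m_ge by linarith
    show ?thesis
    proof (rule depth_region[OF m1])
      fix G :: "(nat \<Rightarrow> real) set"
      assume G: "closed G" "emeasure (lebn n) G \<le> ennreal (exp (8 * real n) * vol (real m) / real m ^ n)"
        "\<And>u v t. u \<in> G \<Longrightarrow> v \<in> G \<Longrightarrow> 0 < t \<Longrightarrow> t < 1 \<Longrightarrow> (\<lambda>i. t * u i + (1 - t) * v i) \<in> G"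
        "\<And>\<theta> b. (\<And>x. x \<in> G \<Longrightarrow> x \<in> Rn n \<Longrightarrow> (\<Sum>i<n. \<theta> i * x i) < b) \<Longrightarrow>
          measure \<mu> {x. b < (\<Sum>i<n. \<theta> i * x i)} \<le> exp (- (real n / real m))"
      have "(\<integral>X. measure \<nu> (convhull (X ` {..<N})) \<partial>(PiM {..<N} (\<lambda>_. \<mu>))) \<le> measure \<nu> G + real N * exp (- (real n / real m))"
        by (rule expected_measure_convhull_le[OF lcD(1,2) lc_nu G(1,3) _ G(4)]) auto
      also have "measure \<nu> G \<le> exp (- (c * real n / l\<^sup>2))"
      proof -
        have "c * 4 \<le> l\<^sup>2 * 4" using big by (simp add: c_def field_simps)
        then have "c / l\<^sup>2 \<le> 1" using l0 by simp
        then have "real n * (c / l\<^sup>2) \<le> real n * 1" by (intro mult_left_mono) auto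
        then have le: "c * real n / l\<^sup>2 \<le> real n" by (simp add: mult.commute)
        have "measure \<nu> G \<le> exp (- real n)"
          using depth_region_measure[OF l0 ln M _ m1 m_ge log_concaveD(1,2)[OF lc_nu] borel_closed[OF G(1)] G(2)] sup
          by (simp add: M_def)
        also have "\<dots> \<le> exp (- (c * real n / l\<^sup>2))" using le by simp
        finally show ?thesis .
      qed
      also have "real N * exp (- (real n / real m)) \<le> exp (- (c * real n / l\<^sup>2))"
      proof -
        have "2 * (c * real n / l\<^sup>2) = real n / (2 * (exp 20 * l\<^sup>2))" using l0 by (simp add: c_def field_simps)
        also have "\<dots> \<le> real n / real m" using m_le m1 big by (intro divide_left_mono) auto
        finally have le: "c * real n / l\<^sup>2 - real n / real m \<le> - (c * real n / l\<^sup>2)" by simp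
        have "real N * exp (- (real n / real m)) \<le> exp (c * real n / l\<^sup>2) * exp (- (real n / real m))"
          using N(2) by (intro mult_right_mono) (auto simp: l_def)
        also have "\<dots> = exp (c * real n / l\<^sup>2 - real n / real m)" by (simp add: exp_add[symmetric])
        also have "\<dots> \<le> exp (- (c * real n / l\<^sup>2))" using le by (simp only: exp_le_cancel_iff)
        finally show ?thesis .
      qed
      finally show ?thesis by (simp add: l_def)
    qed
  qed
  show ?thesis
    by (intro exI[of _ c] conjI allI impI c0 main)
qed

end
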